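(* The problem of minimizing $G(h)$ among nonnegative $h\in H^1(\mathbb{R})$ with $\int_{\mathbb{R}}h\,dx=1$ admits (up to translations) a unique minimizer $\overline{h}$, given by $$\overline{h}(x):=\begin{cases}\frac{3}{4}\ell^{-3}\left(\ell^2-x^2\right), & x\in[-\ell,\ell],\\ 0, & x\notin[-\ell,\ell],\end{cases}\qquad\text{where }\ \ell:=\left(\frac{9}{16\,C_W}\right)^{1/5}.$$
   Context: Let $C_W:=\inf\{\int_{[0,1]\times[0,+\infty)}|\nabla u|^2\,dx\,dy: u(x,0)=x\}$, the infimum being over real-valued weakly differentiable functions $u$ with trace $u(x,0)=x$ for $x\in[0,1]$. For nonnegative $h\in H^1(\mathbb{R})$, $$G(h):=\left(\inf_{u(x,0)=x}\int_{\{h>0\}\times[0,+\infty)}|\nabla u|^2\,dx\,dy\right)+\int_{\mathbb{R}}h'^2\,dx = C_W\sum_i(b_i-a_i)^2+\int_{\mathbb{R}}h'^2\,dx,$$ where the intervals $(a_i,b_i)$ are the (at most countably many) connected components of $\{h>0\}$. *)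

theory Defs
  imports "HOL-Analysis.Analysis"
begin

definition test_fun :: "'a::euclidean_space set \<Rightarrow> ('a \<Rightarrow> real) \<Rightarrow> bool" where
  "test_fun U \<phi> \<longleftrightarrow>
     (\<forall>x. \<phi> differentiable (at x)) \<and>
     (\<forall>b\<in>Basis. continuous_on UNIV (\<lambda>x. frechet_derivative \<phi> (at x) b)) \<and>
     compact (closure {x. \<phi> x \<noteq> 0}) \<and> closure {x. \<phi> x \<noteq> 0} \<subseteq> U"

definition loc_integrable ::
    "'a::euclidean_space set \<Rightarrow> ('a \<Rightarrow> 'b::euclidean_space) \<Rightarrow> bool" where
  "loc_integrable S u \<longleftrightarrow> (\<forall>K. compact K \<and> K \<subseteq> S \<longrightarrow> set_integrable lborel K u)"

text \<open>
  Weak differentiability is tested against compactly supported functions of class C^1, which is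
  equivalent to testing against smooth ones. For functions on the real line the gradient
  is the weak derivative.
\<close>

definition has_weak_gradient ::
    "('a::euclidean_space \<Rightarrow> real) \<Rightarrow> ('a \<Rightarrow> 'a) \<Rightarrow> 'a set \<Rightarrow> bool" where
  "has_weak_gradient u g U \<longleftrightarrow>
     loc_integrable U u \<and> loc_integrable U g \<and>
     (\<forall>\<phi>. test_fun U \<phi> \<longrightarrow> (\<forall>b\<in>Basis.
        (LINT z:U|lborel. u z * frechet_derivative \<phi> (at z) b)
          = - (LINT z:U|lborel. (g z \<bullet> b) * \<phi> z)))"

text \<open>
  The trace of \<open>u\<close> on the bottom side of \<open>\<Omega> \<times> (0,\<infinity>)\<close>, defined as usual by Green's formula. The
  outer normal there is \<open>(0,-1)\<close>. Test functions vanish near the lateral sides but need not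
  vanish on the bottom side, so that nothing is prescribed on the lateral sides.
  Integrability up to the bottom side is automatic if \<open>u\<close> has finite Dirichlet energy, hence
  does not affect the infimum below.
\<close>

definition has_bottom_trace ::
    "(real \<times> real \<Rightarrow> real) \<Rightarrow> (real \<times> real \<Rightarrow> real \<times> real) \<Rightarrow> (real \<Rightarrow> real) \<Rightarrow> real set \<Rightarrow> bool" where
  "has_bottom_trace u g \<tau> \<Omega> \<longleftrightarrow>
     loc_integrable (\<Omega> \<times> {0..}) u \<and> loc_integrable (\<Omega> \<times> {0..}) g \<and>
     (\<forall>\<phi>. test_fun (\<Omega> \<times> UNIV) \<phi> \<longrightarrow> (\<forall>b\<in>Basis.
        (LINT z:\<Omega> \<times> {0<..}|lborel. u z * frechet_derivative \<phi> (at z) b)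
          = - (LINT z:\<Omega> \<times> {0<..}|lborel. (g z \<bullet> b) * \<phi> z)
            + ((0, -1) \<bullet> b) * (LINT x:\<Omega>|lborel. \<tau> x * \<phi> (x, 0))))"

text \<open>
  Energies are extended nonnegative reals; \<open>\<Omega>\<close> is meant to be open. Omitting the bottom side
  (and, for \<open>[0,1] \<times> [0,\<infinity>)\<close>, the lateral sides) from the domain of integration only drops a null set.
\<close>

definition dirichlet_inf :: "real set \<Rightarrow> ennreal" where
  "dirichlet_inf \<Omega> =
     Inf {(\<integral>\<^sup>+z\<in>\<Omega> \<times> {0<..}. ennreal ((norm (g z))\<^sup>2) \<partial>lborel) | u g.
            has_weak_gradient u g (\<Omega> \<times> {0<..}) \<and> has_bottom_trace u g (\<lambda>x. x) \<Omega>}"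

definition C_W :: real where
  "C_W = enn2real (dirichlet_inf {0<..<1})"

text \<open>Elements of \<open>H\<^sup>1(\<real>)\<close> are identified with their continuous representatives.\<close>

definition H1 :: "(real \<Rightarrow> real) set" where
  "H1 = {h. continuous_on UNIV h \<and> integrable lborel (\<lambda>x. (h x)\<^sup>2) \<and>
            (\<exists>g. has_weak_gradient h g UNIV \<and> integrable lborel (\<lambda>x. (g x)\<^sup>2))}"

text \<open>The choice is unique up to a null set.\<close>

definition weak_deriv :: "(real \<Rightarrow> real) \<Rightarrow> real \<Rightarrow> real" where
  "weak_deriv h = (SOME g. has_weak_gradient h g UNIV)"

definition G :: "(real \<Rightarrow> real) \<Rightarrow> ennreal" where
  "G h = dirichlet_inf {x. h x > 0} + (\<integral>\<^sup>+x. ennreal ((weak_deriv h x)\<^sup>2) \<partial>lborel)"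

definition admissible :: "(real \<Rightarrow> real) set" where
  "admissible = {h \<in> H1. (\<forall>x. h x \<ge> 0) \<and> integrable lborel h \<and> (LINT x|lborel. h x) = 1}"

definition is_minimizer :: "(real \<Rightarrow> real) \<Rightarrow> bool" where
  "is_minimizer h \<longleftrightarrow> h \<in> admissible \<and> (\<forall>k\<in>admissible. G h \<le> G k)"

definition ell :: real where
  "ell = (9 / (16 * C_W)) powr (1/5)"

definition h_bar :: "real \<Rightarrow> real" where
  "h_bar x = (if x \<in> {-ell..ell} then 3/4 * ell powi (-3) * (ell\<^sup>2 - x\<^sup>2) else 0)"

end

theory Submission imports Defs begin

text \<open>An unbounded component of \<open>{h > 0}\<close> makes the energy infinite, and the bounded components can be treated separately.
  For such a component \<open>I = (a, b)\<close> write \<open>L\<close> for its length and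
  \<open>m\<close> for the mass of \<open>h\<close> on it. Scaling gives the boundary-value term \<open>C_W * L\<^sup>2\<close>. As \<open>h\<close> vanishes at
  both ends, \<open>m\<close> equals minus the integral of \<open>(x - (a + b) / 2) * h'(x)\<close> over \<open>I\<close>, and completing the square
  shows that the integral of \<open>h'\<^sup>2\<close> over \<open>I\<close> is at least \<open>12 * m\<^sup>2 / L ^ 3\<close>, with equality exactly for the
  parabola. For fixed \<open>m\<close> the sum \<open>C_W * L\<^sup>2 + 12 * m\<^sup>2 / L ^ 3\<close> is minimal at a length proportional to
  \<open>m powr (2/5)\<close>, with minimum \<open>min_energy * m powr (4/5)\<close>. For \<open>m \<le> 1\<close> this is at least \<open>min_energy * m\<close>,
  and strictly larger than that unless \<open>m = 1\<close> (or \<open>m = 0\<close>): splitting the mass costs energy. Summing the linear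
  bound over the components, whose masses add up to \<open>1\<close>, gives \<open>min_energy \<le> G h\<close>. In the case of equality a single
  component carries all the mass, its length is \<open>2 * ell\<close>, and \<open>h\<close> is the parabola (\<open>G_lower_bound\<close>). The
  translates of \<open>h_bar\<close> attain the bound (\<open>G_h_bar\<close>).

  Three facts about the Dirichlet infimum are used. It is superadditive over disjoint open sets
  (\<open>dirichlet_inf_superadditive\<close>), since a competitor on the union restricts to a competitor on every piece and the
  energy is additive. It scales quadratically (\<open>dirichlet_inf_interval\<close>), since \<open>u(x, y)\<close> may be replaced by
  \<open>t + c * u((x - t) / c, y / c)\<close>. And \<open>C_W\<close> is finite and positive: \<open>x * exp (- y)\<close> is a competitor on the strip of
  width one, while testing an arbitrary competitor with a divergence-free vector field, whose normal component
  on the bottom side is not orthogonal to \<open>x\<close>, bounds its energy from below.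

  On the line, the weak formulation must be turned into integration by parts on an interval
  (\<open>weak_gradient_by_parts\<close>). This is done with cutoff functions of class C^1 that converge to the indicator function of
  the interval. It yields the fundamental theorem of calculus for weak derivatives, their uniqueness, and the
  formula for \<open>m\<close> above.\<close>

section \<open>Test functions and local integrability\<close>

lemma test_fun_differentiable: "test_fun U \<phi> \<Longrightarrow> \<phi> differentiable (at x)"
  by (simp add: test_fun_def)

lemma test_fun_continuous: "test_fun U \<phi> \<Longrightarrow> continuous_on UNIV \<phi>"
  unfolding continuous_on_eq_continuous_within
  by (simp add: differentiable_imp_continuous_within test_fun_differentiable)

lemma test_fun_continuous_deriv:
  "test_fun U \<phi> \<Longrightarrow> b \<in> Basis \<Longrightarrow> continuous_on UNIV (\<lambda>x. frechet_derivative \<phi> (at x) b)"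
  by (simp add: test_fun_def)

lemma test_fun_mono: "test_fun U \<phi> \<Longrightarrow> U \<subseteq> V \<Longrightarrow> test_fun V \<phi>"
  by (auto simp: test_fun_def)

lemma test_fun_outside:
  assumes "test_fun U \<phi>" "x \<notin> U"
  shows "\<phi> x = 0"
  using assms closure_subset[of "{x. \<phi> x \<noteq> 0}"] unfolding test_fun_def by auto

lemma frechet_derivative_outside_support:
  fixes \<phi> :: "'a::euclidean_space \<Rightarrow> real"
  assumes "x \<notin> closure {x. \<phi> x \<noteq> 0}"
  shows "frechet_derivative \<phi> (at x) b = 0"
proof -
  have "((\<lambda>_. 0) has_derivative (\<lambda>_. 0)) (at x)" by simp
  then have "(\<phi> has_derivative (\<lambda>_. 0)) (at x)"
  proof (rule has_derivative_transform_within_open)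
    show "open (- closure {x. \<phi> x \<noteq> 0})" by auto
    show "x \<in> - closure {x. \<phi> x \<noteq> 0}" using assms by auto
    show "0 = \<phi> y" if "y \<in> - closure {x. \<phi> x \<noteq> 0}" for y
      using that closure_subset[of "{x. \<phi> x \<noteq> 0}"] by auto
  qed
  then show ?thesis using frechet_derivative_at by metis
qed

lemma test_fun_deriv_outside:
  "test_fun U \<phi> \<Longrightarrow> x \<notin> U \<Longrightarrow> frechet_derivative \<phi> (at x) b = 0"
  unfolding test_fun_def using frechet_derivative_outside_support by blast

lemma test_fun_support:
  "test_fun U \<phi> \<Longrightarrow> \<phi> x \<noteq> 0 \<Longrightarrow> x \<in> U"
  "test_fun U \<phi> \<Longrightarrow> frechet_derivative \<phi> (at x) b \<noteq> 0 \<Longrightarrow> x \<in> U"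
  using test_fun_outside test_fun_deriv_outside by blast+

text \<open>A C^1 function times a test function is again a test function. Thus Green's formula for test functions already contains
  integration by parts against arbitrary C^1 functions.\<close>

lemma test_fun_times:
  assumes "test_fun U \<phi>"
    and u: "\<And>z. (u has_derivative (\<lambda>v. g z \<bullet> v)) (at z)" and g: "continuous_on UNIV g"
  shows "test_fun U (\<lambda>z. u z * \<phi> z)"
    and "frechet_derivative (\<lambda>z. u z * \<phi> z) (at z) b
           = u z * frechet_derivative \<phi> (at z) b + (g z \<bullet> b) * \<phi> z"
proof -
  have D: "((\<lambda>z. u z * \<phi> z) has_derivative
      (\<lambda>b. u z * frechet_derivative \<phi> (at z) b + (g z \<bullet> b) * \<phi> z)) (at z)" for z
    using has_derivative_mult[OF u
        test_fun_differentiable[OF assms(1), unfolded frechet_derivative_works]] .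
  from D show eq: "frechet_derivative (\<lambda>z. u z * \<phi> z) (at z) b
           = u z * frechet_derivative \<phi> (at z) b + (g z \<bullet> b) * \<phi> z" for z b
    using fun_cong[OF frechet_derivative_at[OF D, of z], of b] by simp
  have cu: "continuous_on UNIV u"
    using u by (meson continuous_at_imp_continuous_on has_derivative_continuous)
  have sub: "closure {z. u z * \<phi> z \<noteq> 0} \<subseteq> closure {z. \<phi> z \<noteq> 0}"
    by (intro closure_mono) auto
  then have "compact (closure {z. u z * \<phi> z \<noteq> 0})"
    using compact_Int_closed[of "closure {z. \<phi> z \<noteq> 0}", OF _ closed_closure[of "{z. u z * \<phi> z \<noteq> 0}"]]
      assms(1) by (simp add: test_fun_def Int_absorb1)
  then show "test_fun U (\<lambda>z. u z * \<phi> z)"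
    unfolding test_fun_def eq
  proof (intro conjI allI ballI)
    show "(\<lambda>z. u z * \<phi> z) differentiable at x" for x
      using D unfolding differentiable_def by blast
    show "continuous_on UNIV (\<lambda>x. u x * frechet_derivative \<phi> (at x) b + g x \<bullet> b * \<phi> x)"
      if "b \<in> Basis" for b
      by (intro continuous_intros cu g test_fun_continuous[OF assms(1)]
          test_fun_continuous_deriv[OF assms(1) that])
    show "closure {z. u z * \<phi> z \<noteq> 0} \<subseteq> U"
      using sub assms(1) unfolding test_fun_def by blast
  qed
qed

lemma set_integrable_mult_continuous:
  fixes u w :: "'a::euclidean_space \<Rightarrow> real"
  assumes u: "set_integrable lborel K u" and K: "compact K" and w: "continuous_on K w"
  shows "set_integrable lborel K (\<lambda>x. u x * w x)"
proof -
  have "bounded (w ` K)"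
    by (intro compact_imp_bounded compact_continuous_image w K)
  then obtain B where B: "\<And>x. x \<in> K \<Longrightarrow> \<bar>w x\<bar> \<le> B" by (auto simp: bounded_iff)
  have [measurable]: "(\<lambda>x. indicator K x *\<^sub>R w x) \<in> borel_measurable borel"
    by (rule borel_measurable_continuous_on_indicator[OF _ w]) (simp add: K borel_compact)
  have i: "integrable lborel (\<lambda>x. indicator K x *\<^sub>R u x)"
    using u by (simp add: set_integrable_def)
  have "integrable lborel (\<lambda>x. (indicator K x *\<^sub>R u x) * (indicator K x *\<^sub>R w x))"
  proof (rule Bochner_Integration.integrable_bound)
    show "integrable lborel (\<lambda>x. B * (indicator K x *\<^sub>R u x))" using i by simp
    show "(\<lambda>x. (indicator K x *\<^sub>R u x) * (indicator K x *\<^sub>R w x)) \<in> borel_measurable lborel"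
      using borel_measurable_integrable[OF i] by measurable
    show "AE x in lborel. norm ((indicator K x *\<^sub>R u x) * (indicator K x *\<^sub>R w x)) \<le> norm (B * (indicator K x *\<^sub>R u x))"
    proof (rule AE_I2)
      fix x
      have "\<bar>w x\<bar> * \<bar>u x\<bar> \<le> \<bar>B\<bar> * \<bar>u x\<bar>" if "x \<in> K"
        using B[OF that] by (intro mult_right_mono) auto
      then show "norm ((indicator K x *\<^sub>R u x) * (indicator K x *\<^sub>R w x)) \<le> norm (B * (indicator K x *\<^sub>R u x))"
        by (auto simp: indicator_def abs_mult mult.commute)
    qed
  qed
  moreover have "(indicator K x *\<^sub>R u x) * (indicator K x *\<^sub>R w x) = indicator K x *\<^sub>R (u x * w x)" for x
    by (auto simp: indicator_def)
  ultimately show ?thesis unfolding set_integrable_def by (simp only:)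
qed

lemma integrable_mult_compact_support:
  fixes u w :: "'a::euclidean_space \<Rightarrow> real"
  assumes u: "set_integrable lborel K u" and K: "compact K"
    and w: "continuous_on UNIV w" "\<And>x. x \<notin> K \<Longrightarrow> w x = 0"
  shows "integrable lborel (\<lambda>x. u x * w x)"
proof -
  have "set_integrable lborel K (\<lambda>x. u x * w x)"
    by (rule set_integrable_mult_continuous[OF u K continuous_on_subset[OF w(1)]]) simp
  moreover have "indicator K x *\<^sub>R (u x * w x) = u x * w x" for x
    using w(2)[of x] by (cases "x \<in> K") auto
  ultimately show ?thesis unfolding set_integrable_def by (simp only:)
qed

lemma integrable_continuous_compact_support:
  fixes w :: "'a::euclidean_space \<Rightarrow> real"
  assumes "compact K" "continuous_on UNIV w" "\<And>x. x \<notin> K \<Longrightarrow> w x = 0"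
  shows "integrable lborel w"
proof -
  have "set_integrable lborel K (\<lambda>_. 1::real)"
    unfolding set_integrable_def using assms(1) by (intro borel_integrable_compact) auto
  from integrable_mult_compact_support[OF this assms] show ?thesis by simp
qed

lemma integrable_test_fun:
  assumes "test_fun U \<phi>" "continuous_on UNIV u"
  shows "integrable lborel (\<lambda>z. u z * \<phi> z)"
    and "b \<in> Basis \<Longrightarrow> integrable lborel (\<lambda>z. u z * frechet_derivative \<phi> (at z) b)"
proof -
  let ?K = "closure {z. \<phi> z \<noteq> 0}"
  have K: "compact ?K" using assms by (simp add: test_fun_def)
  have z: "\<phi> z = 0" if "z \<notin> ?K" for z using that closure_subset[of "{z. \<phi> z \<noteq> 0}"] by auto
  show "integrable lborel (\<lambda>z. u z * \<phi> z)"
  proof (rule integrable_continuous_compact_support[OF K])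
    show "continuous_on UNIV (\<lambda>z. u z * \<phi> z)"
      by (intro continuous_on_mult assms(2) test_fun_continuous[OF assms(1)])
    show "u x * \<phi> x = 0" if "x \<notin> ?K" for x using z[OF that] by simp
  qed
  show "integrable lborel (\<lambda>z. u z * frechet_derivative \<phi> (at z) b)" if "b \<in> Basis"
  proof (rule integrable_continuous_compact_support[OF K])
    show "continuous_on UNIV (\<lambda>z. u z * frechet_derivative \<phi> (at z) b)"
      by (intro continuous_on_mult assms(2) test_fun_continuous_deriv[OF assms(1) that])
    show "u x * frechet_derivative \<phi> (at x) b = 0" if "x \<notin> ?K" for x
      using frechet_derivative_outside_support[OF that] by simp
  qed
qed

text \<open>Lets the domain of integration grow or shrink outside the support of a test function.\<close>

lemma set_integral_support_cong:
  fixes f :: "'a \<Rightarrow> real"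
  assumes "A \<subseteq> B" "\<And>x. x \<in> B - A \<Longrightarrow> f x = 0"
  shows "(LINT x:A|M. f x) = (LINT x:B|M. f x)"
  unfolding set_lebesgue_integral_def
  by (rule arg_cong[where f="integral\<^sup>L M"], rule ext) (use assms in \<open>auto simp: indicator_def\<close>)

lemma continuous_imp_loc_integrable:
  fixes u :: "'a::euclidean_space \<Rightarrow> 'b::euclidean_space"
  shows "continuous_on UNIV u \<Longrightarrow> loc_integrable S u"
  unfolding loc_integrable_def set_integrable_def
  by (auto intro!: borel_integrable_compact intro: continuous_on_subset)

lemma loc_integrable_mono: "loc_integrable T u \<Longrightarrow> S \<subseteq> T \<Longrightarrow> loc_integrable S u"
  unfolding loc_integrable_def by blast

text \<open>An open set is an increasing union of compact sets that eventually contain each point, so the cut-off functions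
  are pointwise limits of measurable functions. Without this, the energy of a competitor need not be additive in the domain.\<close>

lemma loc_integrable_measurable:
  fixes u :: "'a::euclidean_space \<Rightarrow> 'b::euclidean_space"
  assumes "open U" "loc_integrable U u"
  shows "(\<lambda>z. indicator U z *\<^sub>R u z) \<in> borel_measurable borel"
proof -
  obtain C :: "nat \<Rightarrow> 'a set" where C: "\<And>n. compact (C n)" "\<And>n. C n \<subseteq> U"
    "\<And>K. \<lbrakk>compact K; K \<subseteq> U\<rbrakk> \<Longrightarrow> \<exists>N. \<forall>n\<ge>N. K \<subseteq> C n"
    by (rule open_Union_compact_subsets[OF assms(1)]) (rule that)
  show ?thesis
  proof (rule borel_measurable_LIMSEQ_metric)
    show "(\<lambda>z. indicator (C n) z *\<^sub>R u z) \<in> borel_measurable borel" for n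
    proof -
      have "integrable lborel (\<lambda>z. indicator (C n) z *\<^sub>R u z)"
        using assms(2) C(1,2)[of n] unfolding loc_integrable_def set_integrable_def by blast
      from borel_measurable_integrable[OF this] show ?thesis by simp
    qed
    show "(\<lambda>n. indicator (C n) z *\<^sub>R u z) \<longlonglongrightarrow> indicator U z *\<^sub>R u z" for z
    proof (cases "z \<in> U")
      case True
      then obtain N where "\<forall>n\<ge>N. {z} \<subseteq> C n" using C(3)[of "{z}"] by auto
      then have "\<forall>\<^sub>F n in sequentially. indicator (C n) z *\<^sub>R u z = indicator U z *\<^sub>R u z"
        using True unfolding eventually_sequentially by (intro exI[of _ N]) auto
      then show ?thesis by (rule tendsto_eventually)
    next
      case False
      then have "\<And>n. z \<notin> C n" using C(2) by auto
      then show ?thesis using False by simp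
    qed
  qed
qed

section \<open>Green's formula in the upper half-plane\<close>

lemma lborel_fubini_pair:
  fixes F :: "real \<times> real \<Rightarrow> real"
  assumes "integrable lborel F"
  shows "(\<integral>z. F z \<partial>lborel) = (\<integral>x. (\<integral>y. F (x, y) \<partial>lborel) \<partial>lborel)"
    and "(\<integral>z. F z \<partial>lborel) = (\<integral>y. (\<integral>x. F (x, y) \<partial>lborel) \<partial>lborel)"
proof -
  have F: "case_prod (\<lambda>x y. F (x, y)) = F" by auto
  show "(\<integral>z. F z \<partial>lborel) = (\<integral>x. (\<integral>y. F (x, y) \<partial>lborel) \<partial>lborel)"
    using lborel_pair.integral_fst[of "\<lambda>x y. F (x, y)", unfolded lborel_prod F, OF assms] by simp
  show "(\<integral>z. F z \<partial>lborel) = (\<integral>y. (\<integral>x. F (x, y) \<partial>lborel) \<partial>lborel)"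
    using lborel_pair.integral_snd[of "\<lambda>x y. F (x, y)", unfolded lborel_prod F, OF assms] by simp
qed

text \<open>By Fubini and the fundamental theorem of calculus along the lines parallel to \<open>b\<close>. Horizontal lines contribute
  nothing, and a vertical half-line contributes minus the value at its foot.\<close>

lemma green_test_fun:
  fixes f :: "real \<times> real \<Rightarrow> real"
  assumes f: "test_fun UNIV f" and b: "b \<in> Basis"
  shows "(LINT z:UNIV \<times> {0<..}|lborel. frechet_derivative f (at z) b)
           = ((0, -1) \<bullet> b) * (LINT x|lborel. f (x, 0))"
proof -
  let ?d = "\<lambda>z. frechet_derivative f (at z) b"
  let ?D = "\<lambda>z. indicator (UNIV \<times> {0<..}) z *\<^sub>R ?d z"
  have "bounded {z. f z \<noteq> 0}"
    using f closure_subset bounded_subset compact_imp_bounded by (metis test_fun_def)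
  then obtain M0 where M0: "\<And>z. f z \<noteq> 0 \<Longrightarrow> norm z \<le> M0" by (auto simp: bounded_iff)
  \<comment> \<open>A bound strictly beyond the support, so that the derivative vanishes on the boundary of the box as well.\<close>
  define M where "M = max M0 0 + 1"
  have "closure {z. f z \<noteq> 0} \<subseteq> cball 0 (max M0 0)"
    by (rule closure_minimal) (auto intro!: max.coboundedI1 dest!: M0)
  then have K: "norm z < M" if "z \<in> closure {z. f z \<noteq> 0}" for z
  proof -
    have "z \<in> cball 0 (max M0 0)" using that \<open>_ \<subseteq> cball 0 (max M0 0)\<close> by blast
    then show ?thesis unfolding M_def by simp
  qed
  have z: "f (x, y) = 0" "?d (x, y) = 0" if "\<bar>x\<bar> \<ge> M \<or> \<bar>y\<bar> \<ge> M" for x y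
  proof -
    have "norm (x, y) \<ge> M" using that norm_fst_le[of x y] norm_snd_le[of y x] by (auto simp: real_norm_def)
    then have n: "(x, y) \<notin> closure {z. f z \<noteq> 0}" using K[of "(x, y)"] by auto
    then show "f (x, y) = 0" using closure_subset[of "{z. f z \<noteq> 0}"] by auto
    show "?d (x, y) = 0" using n by (rule frechet_derivative_outside_support)
  qed
  have M: "M > 0" by (simp add: M_def)
  have int: "integrable lborel ?D"
  proof -
    have "integrable lborel (\<lambda>z. 1 * ?d z)"
      using integrable_test_fun(2)[OF f _ b, of "\<lambda>_. 1"] by (simp add: continuous_intros)
    then have "set_integrable lborel UNIV ?d" by (simp add: set_integrable_def)
    then have "set_integrable lborel (UNIV \<times> {0<..}) ?d"
      by (rule set_integrable_subset)
        (auto intro!: borel_open open_Times)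
    then show ?thesis by (simp add: set_integrable_def)
  qed
  have cd: "continuous_on UNIV ?d" by (rule test_fun_continuous_deriv[OF f b])
  have D: "(f has_derivative frechet_derivative f (at z)) (at z)" for z
    using test_fun_differentiable[OF f] frechet_derivative_works by blast
  have lin: "frechet_derivative f (at z) (r *\<^sub>R w) = r * frechet_derivative f (at z) w" for z r w
    using linear_cmul[OF linear_frechet_derivative[OF test_fun_differentiable[OF f, of z]], of r w] by simp
  consider "b = (1, 0)" | "b = (0, 1)" using b by (auto simp: Basis_prod_def)
  then show ?thesis
  proof cases
    case 1
    have inner: "(\<integral>x. ?D (x, y) \<partial>lborel) = 0" for y
    proof -
      have "(\<integral>x. indicator {-M..M} x *\<^sub>R ?d (x, y) \<partial>lborel) = f (M, y) - f (-M, y)"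
      proof (rule integral_FTC_atLeastAtMost)
        show "((\<lambda>x. f (x, y)) has_vector_derivative ?d (x, y)) (at x within {-M..M})" for x
        proof -
          have "((\<lambda>x. f (x, y)) has_derivative (\<lambda>v. frechet_derivative f (at (x, y)) (v, 0))) (at x)"
            by (rule has_derivative_compose[of "\<lambda>x. (x, y)" "\<lambda>v. (v, 0)" _ _ f, OF _ D])
               (auto intro!: derivative_eq_intros)
          moreover have "frechet_derivative f (at (x, y)) (v, 0) = v *\<^sub>R ?d (x, y)" for v
            using lin[of "(x,y)" v "(1,0)"] 1 by simp
          ultimately show ?thesis
            unfolding has_vector_derivative_def
            by (auto intro: has_derivative_at_withinI)
        qed
        show "continuous_on {-M..M} (\<lambda>x. ?d (x, y))"
          by (rule continuous_on_compose2[OF cd]) (auto intro!: continuous_intros)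
      qed (use M in auto)
      also have "\<dots> = 0" using z(1)[of M y] z(1)[of "-M" y] M by simp
      finally have "(\<integral>x. indicator {-M..M} x *\<^sub>R ?d (x, y) \<partial>lborel) = 0" .
      moreover have "indicator {-M..M} x *\<^sub>R ?d (x, y) = ?d (x, y)" for x
      proof (cases "\<bar>x\<bar> \<le> M")
        case True then show ?thesis by (simp add: abs_le_iff)
      next
        case False
        then have "M \<le> \<bar>x\<bar>" by simp
        then show ?thesis using z(2)[of x y] by simp
      qed
      ultimately have *: "(\<integral>x. ?d (x, y) \<partial>lborel) = 0" by (simp only:)
      have eq: "?D (x, y) = indicator {0<..} y * ?d (x, y)" for x by (simp add: indicator_def)
      show ?thesis using * unfolding eq by simp
    qed
    have "(\<integral>z. ?D z \<partial>lborel) = (\<integral>y. (\<integral>x. ?D (x, y) \<partial>lborel) \<partial>lborel)"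
      by (rule lborel_fubini_pair(2)[OF int])
    then show ?thesis using inner 1 by (simp add: set_lebesgue_integral_def)
  next
    case 2
    have inner: "(\<integral>y. ?D (x, y) \<partial>lborel) = - f (x, 0)" for x
    proof -
      have "(\<integral>y. indicator {0..M} y *\<^sub>R ?d (x, y) \<partial>lborel) = f (x, M) - f (x, 0)"
      proof (rule integral_FTC_atLeastAtMost)
        show "((\<lambda>y. f (x, y)) has_vector_derivative ?d (x, y)) (at y within {0..M})" for y
        proof -
          have "((\<lambda>y. f (x, y)) has_derivative (\<lambda>v. frechet_derivative f (at (x, y)) (0, v))) (at y)"
            by (rule has_derivative_compose[of "\<lambda>y. (x, y)" "\<lambda>v. (0, v)" _ _ f, OF _ D])
               (auto intro!: derivative_eq_intros)
          moreover have "frechet_derivative f (at (x, y)) (0, v) = v *\<^sub>R ?d (x, y)" for v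
            using lin[of "(x,y)" v "(0,1)"] 2 by simp
          ultimately show ?thesis
            unfolding has_vector_derivative_def
            by (auto intro: has_derivative_at_withinI)
        qed
        show "continuous_on {0..M} (\<lambda>y. ?d (x, y))"
          by (rule continuous_on_compose2[OF cd]) (auto intro!: continuous_intros)
      qed (use M in auto)
      moreover have "f (x, M) = 0" using z(1)[of x M] M by simp
      moreover have "(\<integral>y. ?D (x, y) \<partial>lborel) = (\<integral>y. indicator {0..M} y *\<^sub>R ?d (x, y) \<partial>lborel)"
      proof (rule integral_cong_AE)
        show "(\<lambda>y. ?D (x, y)) \<in> borel_measurable lborel"
        proof -
          have "(\<lambda>y. ?d (x, y)) \<in> borel_measurable borel"
            by (intro borel_measurable_continuous_onI continuous_on_compose2[OF cd])
               (auto intro!: continuous_intros)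
          moreover have "?D (x, y) = indicator {0<..} y * ?d (x, y)" for y by (simp add: indicator_def)
          ultimately show ?thesis by simp
        qed
        show "(\<lambda>y. indicator {0..M} y *\<^sub>R ?d (x, y)) \<in> borel_measurable lborel"
        proof -
          have "(\<lambda>y. ?d (x, y)) \<in> borel_measurable borel"
            by (intro borel_measurable_continuous_onI continuous_on_compose2[OF cd])
               (auto intro!: continuous_intros)
          then show ?thesis by simp
        qed
        show "AE y in lborel. ?D (x, y) = indicator {0..M} y *\<^sub>R ?d (x, y)"
          using AE_lborel_singleton[of 0]
                  proof eventually_elim
          case (elim y)
          show ?case
          proof (cases "y \<le> M")
            case True then show ?thesis using elim by (auto simp: indicator_def)
          next
            case False
            then have "M \<le> \<bar>y\<bar>" by simp
            then show ?thesis using z(2)[of x y] by simp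
          qed
        qed
      qed
      ultimately show ?thesis by simp
    qed
    have "(\<integral>z. ?D z \<partial>lborel) = (\<integral>x. (\<integral>y. ?D (x, y) \<partial>lborel) \<partial>lborel)"
      by (rule lborel_fubini_pair(1)[OF int])
    then show ?thesis using inner 2 by (simp add: set_lebesgue_integral_def)
  qed
qed

text \<open>For functions of class C^1 up to the bottom side the trace defined by duality is the restriction.\<close>

lemma has_bottom_trace_C1:
  assumes u: "\<And>z. (u has_derivative (\<lambda>v. g z \<bullet> v)) (at z)" and g: "continuous_on UNIV g"
  shows "has_bottom_trace u g (\<lambda>x. u (x, 0)) \<Omega>"
proof -
  have cu: "continuous_on UNIV u"
    using u by (meson continuous_at_imp_continuous_on has_derivative_continuous)
  show ?thesis
    unfolding has_bottom_trace_def
  proof (intro conjI continuous_imp_loc_integrable cu g allI impI ballI)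
    fix \<phi> :: "real \<times> real \<Rightarrow> real" and b :: "real \<times> real"
    assume \<phi>: "test_fun (\<Omega> \<times> UNIV) \<phi>" and b: "b \<in> Basis"
    let ?U = "UNIV \<times> {0<..} :: (real \<times> real) set"
    let ?V = "\<Omega> \<times> {0<..} :: (real \<times> real) set"
    have U: "?U \<in> sets lborel" by (auto intro!: borel_open open_Times)
    have int: "set_integrable lborel ?U f" if "integrable lborel f" for f :: "real \<times> real \<Rightarrow> real"
      using set_integrable_subset[of lborel UNIV f ?U] that U by (simp add: set_integrable_def)
    have gb: "continuous_on UNIV (\<lambda>z. g z \<bullet> b)" by (intro continuous_intros g)
    have "test_fun UNIV (\<lambda>z. u z * \<phi> z)"
      by (rule test_fun_mono[OF test_fun_times(1)[OF \<phi> u g]]) auto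
    from green_test_fun[OF this b]
    have "(LINT z:?U|lborel. u z * frechet_derivative \<phi> (at z) b + (g z \<bullet> b) * \<phi> z)
             = ((0, -1) \<bullet> b) * (LINT x|lborel. u (x, 0) * \<phi> (x, 0))"
      by (simp only: test_fun_times(2)[OF \<phi> u g])
    also have "(LINT z:?U|lborel. u z * frechet_derivative \<phi> (at z) b + (g z \<bullet> b) * \<phi> z)
        = (LINT z:?U|lborel. u z * frechet_derivative \<phi> (at z) b) + (LINT z:?U|lborel. (g z \<bullet> b) * \<phi> z)"
      by (intro set_integral_add int integrable_test_fun[OF \<phi>] cu gb b)
    also have "(LINT z:?U|lborel. u z * frechet_derivative \<phi> (at z) b) = (LINT z:?V|lborel. u z * frechet_derivative \<phi> (at z) b)"
      by (rule set_integral_support_cong[symmetric]) (auto dest: test_fun_support[OF \<phi>])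
    also have "(LINT z:?U|lborel. (g z \<bullet> b) * \<phi> z) = (LINT z:?V|lborel. (g z \<bullet> b) * \<phi> z)"
      by (rule set_integral_support_cong[symmetric]) (auto dest: test_fun_support[OF \<phi>])
    also have "(LINT x|lborel. u (x, 0) * \<phi> (x, 0)) = (LINT x:UNIV|lborel. u (x, 0) * \<phi> (x, 0))"
      by (simp add: set_lebesgue_integral_def)
    also have "\<dots> = (LINT x:\<Omega>|lborel. u (x, 0) * \<phi> (x, 0))"
      by (rule set_integral_support_cong[symmetric]) (auto dest: test_fun_support[OF \<phi>])
    finally show "(LINT z:?V|lborel. u z * frechet_derivative \<phi> (at z) b)
          = - (LINT z:?V|lborel. (g z \<bullet> b) * \<phi> z)
            + ((0, -1) \<bullet> b) * (LINT x:\<Omega>|lborel. u (x, 0) * \<phi> (x, 0))" by linarith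
  qed
qed

text \<open>A test function on \<open>\<Omega> \<times> UNIV\<close> need not vanish at the bottom side, so integrability has to come from the compact part
  of its support in the closed half-plane.\<close>

lemma set_integrable_upper_half:
  fixes k w :: "real \<times> real \<Rightarrow> real"
  assumes k: "loc_integrable (\<Omega> \<times> {0..}) k" and K: "compact K" "K \<subseteq> \<Omega> \<times> UNIV"
    and w: "continuous_on UNIV w" "\<And>z. z \<notin> K \<Longrightarrow> w z = 0"
  shows "set_integrable lborel (\<Omega> \<times> {0<..}) (\<lambda>z. k z * w z)"
proof -
  let ?H = "UNIV \<times> {0<..} :: (real \<times> real) set" and ?H' = "UNIV \<times> {0..} :: (real \<times> real) set"
  have comp: "compact (K \<inter> ?H')" by (intro compact_Int_closed K closed_Times) auto
  then have "set_integrable lborel (K \<inter> ?H') k"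
    using k K(2) unfolding loc_integrable_def by blast
  moreover have "K \<inter> ?H \<in> sets lborel"
  proof -
    have "K \<in> sets borel" using K(1) by (intro borel_closed compact_imp_closed)
    moreover have "?H \<in> sets borel" by (intro borel_open open_Times) auto
    ultimately show ?thesis by simp
  qed
  ultimately have "set_integrable lborel (K \<inter> ?H) k"
    by (rule set_integrable_subset) auto
  moreover have "indicator (K \<inter> ?H) z *\<^sub>R k z = indicator K z *\<^sub>R (indicator ?H z * k z)" for z
    by (auto simp: indicator_def)
  ultimately have "set_integrable lborel K (\<lambda>z. indicator ?H z * k z)"
    unfolding set_integrable_def by (simp only:)
  from integrable_mult_compact_support[OF this K(1) w]
  have "integrable lborel (\<lambda>z. indicator ?H z * k z * w z)" .
  moreover have "indicator ?H z * k z * w z = indicator (\<Omega> \<times> {0<..}) z *\<^sub>R (k z * w z)" for z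
    using K(2) w(2)[of z] by (cases "z \<in> K") (auto simp: indicator_def)
  ultimately show ?thesis by (simp add: set_integrable_def)
qed

section \<open>Bottom traces and the Dirichlet infimum\<close>

text \<open>Test functions supported in the open half-strip vanish at the bottom side, so they do not see the boundary term. Hence
  only the trace condition has to be checked for a competitor.\<close>

lemma bottom_trace_imp_weak_gradient:
  assumes "has_bottom_trace u g \<tau> \<Omega>"
  shows "has_weak_gradient u g (\<Omega> \<times> {0<..})"
  unfolding has_weak_gradient_def
proof (intro conjI allI impI ballI)
  have sub: "\<Omega> \<times> {0<..} \<subseteq> \<Omega> \<times> {0::real..}" by auto
  show "loc_integrable (\<Omega> \<times> {0<..}) u" "loc_integrable (\<Omega> \<times> {0<..}) g"
    using assms loc_integrable_mono[OF _ sub] by (auto simp: has_bottom_trace_def)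
  fix \<phi> :: "real \<times> real \<Rightarrow> real" and b :: "real \<times> real"
  assume \<phi>: "test_fun (\<Omega> \<times> {0<..}) \<phi>" and b: "b \<in> Basis"
  have "test_fun (\<Omega> \<times> UNIV) \<phi>" using \<phi> by (rule test_fun_mono) auto
  moreover have "\<phi> (x, 0) = 0" for x by (rule test_fun_outside[OF \<phi>]) auto
  ultimately show "(LINT z:\<Omega> \<times> {0<..}|lborel. u z * frechet_derivative \<phi> (at z) b)
      = - (LINT z:\<Omega> \<times> {0<..}|lborel. (g z \<bullet> b) * \<phi> z)"
    using assms b by (auto simp: has_bottom_trace_def set_lebesgue_integral_def)
qed

lemma has_bottom_trace_subset:
  assumes tr: "has_bottom_trace u g \<tau> \<Omega>" and sub: "\<Omega>' \<subseteq> \<Omega>"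
  shows "has_bottom_trace u g \<tau> \<Omega>'"
  unfolding has_bottom_trace_def
proof (intro conjI allI impI ballI)
  have sub': "\<Omega>' \<times> {0..} \<subseteq> \<Omega> \<times> {0::real..}" using sub by auto
  show "loc_integrable (\<Omega>' \<times> {0..}) u" "loc_integrable (\<Omega>' \<times> {0..}) g"
    using tr loc_integrable_mono[OF _ sub'] by (auto simp: has_bottom_trace_def)
  fix \<phi> :: "real \<times> real \<Rightarrow> real" and b :: "real \<times> real"
  assume \<phi>: "test_fun (\<Omega>' \<times> UNIV) \<phi>" and b: "b \<in> Basis"
  let ?U = "\<Omega> \<times> {0<..} :: (real \<times> real) set"
  let ?V = "\<Omega>' \<times> {0<..} :: (real \<times> real) set"
  have "test_fun (\<Omega> \<times> UNIV) \<phi>" using \<phi> by (rule test_fun_mono) (use sub in auto)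
  then have "(LINT z:?U|lborel. u z * frechet_derivative \<phi> (at z) b)
          = - (LINT z:?U|lborel. (g z \<bullet> b) * \<phi> z)
            + ((0, -1) \<bullet> b) * (LINT x:\<Omega>|lborel. \<tau> x * \<phi> (x, 0))"
    using tr b by (auto simp: has_bottom_trace_def)
  moreover have "(LINT z:?V|lborel. u z * frechet_derivative \<phi> (at z) b) = (LINT z:?U|lborel. u z * frechet_derivative \<phi> (at z) b)"
    by (rule set_integral_support_cong) (use sub in \<open>auto dest: test_fun_support[OF \<phi>]\<close>)
  moreover have "(LINT z:?V|lborel. (g z \<bullet> b) * \<phi> z) = (LINT z:?U|lborel. (g z \<bullet> b) * \<phi> z)"
    by (rule set_integral_support_cong) (use sub in \<open>auto dest: test_fun_support[OF \<phi>]\<close>)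
  moreover have "(LINT x:\<Omega>'|lborel. \<tau> x * \<phi> (x, 0)) = (LINT x:\<Omega>|lborel. \<tau> x * \<phi> (x, 0))"
    by (rule set_integral_support_cong) (use sub in \<open>auto dest: test_fun_support[OF \<phi>]\<close>)
  ultimately show "(LINT z:?V|lborel. u z * frechet_derivative \<phi> (at z) b)
          = - (LINT z:?V|lborel. (g z \<bullet> b) * \<phi> z)
            + ((0, -1) \<bullet> b) * (LINT x:\<Omega>'|lborel. \<tau> x * \<phi> (x, 0))" by simp
qed

lemma dirichlet_inf_le:
  assumes "has_bottom_trace u g (\<lambda>x. x) \<Omega>"
  shows "dirichlet_inf \<Omega> \<le> (\<integral>\<^sup>+z\<in>\<Omega> \<times> {0<..}. ennreal ((norm (g z))\<^sup>2) \<partial>lborel)"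
  unfolding dirichlet_inf_def
  by (rule Inf_lower) (use assms bottom_trace_imp_weak_gradient[OF assms] in blast)

lemma le_dirichlet_inf:
  assumes "\<And>u g. has_bottom_trace u g (\<lambda>x. x) \<Omega> \<Longrightarrow>
     c \<le> (\<integral>\<^sup>+z\<in>\<Omega> \<times> {0<..}. ennreal ((norm (g z))\<^sup>2) \<partial>lborel)"
  shows "c \<le> dirichlet_inf \<Omega>"
  unfolding dirichlet_inf_def by (rule Inf_greatest) (use assms in blast)

lemma dirichlet_inf_mono: "\<Omega>' \<subseteq> \<Omega> \<Longrightarrow> dirichlet_inf \<Omega>' \<le> dirichlet_inf \<Omega>"
  by (rule le_dirichlet_inf, rule order_trans[OF dirichlet_inf_le[OF has_bottom_trace_subset]])
     (auto intro!: nn_integral_mono simp: indicator_def)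

lemma energy_density_measurable:
  assumes "has_bottom_trace u g \<tau> \<Omega>" "open \<Omega>"
  shows "(\<lambda>z. ennreal ((norm (g z))\<^sup>2) * indicator (\<Omega> \<times> {0<..}) z) \<in> borel_measurable borel"
proof -
  have "open (\<Omega> \<times> {0::real<..})" using assms(2) by (intro open_Times) auto
  then have [measurable]: "(\<lambda>z. indicator (\<Omega> \<times> {0<..}) z *\<^sub>R g z) \<in> borel_measurable borel"
    using bottom_trace_imp_weak_gradient[OF assms(1)]
    by (intro loc_integrable_measurable) (auto simp: has_weak_gradient_def)
  have eq: "ennreal ((norm (g z))\<^sup>2) * indicator (\<Omega> \<times> {0<..}) z
        = ennreal ((norm (indicator (\<Omega> \<times> {0<..}) z *\<^sub>R g z))\<^sup>2)" for z
    by (auto simp: indicator_def)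
  show ?thesis unfolding eq by measurable
qed

text \<open>The restrictions of a competitor on the union compete on the pieces, and the energy density is the density of a measure.
  Countable additivity of that measure gives the claim for countable families directly.\<close>

lemma dirichlet_inf_superadditive:
  assumes cnt: "countable \<C>" and op: "\<And>C. C \<in> \<C> \<Longrightarrow> open C" and disj: "disjoint \<C>"
  shows "(\<integral>\<^sup>+C. dirichlet_inf C \<partial>count_space \<C>) \<le> dirichlet_inf (\<Union>\<C>)"
proof (rule le_dirichlet_inf)
  fix u g assume tr: "has_bottom_trace u g (\<lambda>x. x) (\<Union>\<C>)"
  let ?S = "\<lambda>C. C \<times> {0::real<..}"
  let ?f = "\<lambda>z. ennreal ((norm (g z))\<^sup>2) * indicator (?S (\<Union>\<C>)) z"
  have opS: "open (?S C)" if "C \<in> \<C>" for C using op[OF that] by (intro open_Times) auto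
  have [measurable]: "?f \<in> borel_measurable borel"
    by (rule energy_density_measurable[OF tr]) (auto intro: op)
  have "(\<integral>\<^sup>+C. dirichlet_inf C \<partial>count_space \<C>) \<le> (\<integral>\<^sup>+C. emeasure (density lborel ?f) (?S C) \<partial>count_space \<C>)"
  proof (rule nn_integral_mono)
    fix C assume "C \<in> space (count_space \<C>)"
    then have C: "C \<in> \<C>" by simp
    have "dirichlet_inf C \<le> (\<integral>\<^sup>+z\<in>?S C. ennreal ((norm (g z))\<^sup>2) \<partial>lborel)"
      by (rule dirichlet_inf_le[OF has_bottom_trace_subset[OF tr]]) (use C in auto)
    also have "\<dots> = (\<integral>\<^sup>+z. ?f z * indicator (?S C) z \<partial>lborel)"
      by (rule nn_integral_cong) (use C in \<open>auto simp: indicator_def\<close>)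
    also have "\<dots> = emeasure (density lborel ?f) (?S C)"
      using opS[OF C] by (subst emeasure_density) auto
    finally show "dirichlet_inf C \<le> emeasure (density lborel ?f) (?S C)" .
  qed
  also have "\<dots> = emeasure (density lborel ?f) (\<Union>(?S ` \<C>))"
    by (rule emeasure_UN_countable[symmetric])
       (use cnt disj opS in \<open>auto simp: disjoint_family_on_def disjoint_def\<close>)
  also have "\<Union>(?S ` \<C>) = ?S (\<Union>\<C>)" by auto
  also have "emeasure (density lborel ?f) (?S (\<Union>\<C>)) = (\<integral>\<^sup>+z. ?f z * indicator (?S (\<Union>\<C>)) z \<partial>lborel)"
    using op by (intro emeasure_density) (auto intro!: borel_open open_Times)
  also have "\<dots> = (\<integral>\<^sup>+z\<in>?S (\<Union>\<C>). ennreal ((norm (g z))\<^sup>2) \<partial>lborel)"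
    by (rule nn_integral_cong) (auto simp: indicator_def)
  finally show "(\<integral>\<^sup>+C. dirichlet_inf C \<partial>count_space \<C>) \<le> (\<integral>\<^sup>+z\<in>?S (\<Union>\<C>). ennreal ((norm (g z))\<^sup>2) \<partial>lborel)" .
qed

section \<open>Finiteness and positivity of the constant\<close>

text \<open>The competitor is \<open>u(x, y) = x * exp (- y)\<close>, with \<open>\<bar>\<nabla>u\<bar>\<^sup>2 = (1 + x\<^sup>2) * exp (- 2 * y) \<le> 2 * exp (- 2 * y)\<close> on the strip.\<close>

lemma dirichlet_inf_unit_finite: "dirichlet_inf {0<..<1} < \<infinity>"
proof -
  define u where "u = (\<lambda>z::real\<times>real. fst z * exp (- snd z))"
  define g where "g = (\<lambda>z::real\<times>real. (exp (- snd z), - fst z * exp (- snd z)))"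
  have "has_bottom_trace u g (\<lambda>x. u (x, 0)) {0<..<1}"
  proof (rule has_bottom_trace_C1)
    show "(u has_derivative (\<lambda>v. g z \<bullet> v)) (at z)" for z
      unfolding u_def g_def
      by (auto intro!: derivative_eq_intros simp: fun_eq_iff inner_prod_def algebra_simps)
    show "continuous_on UNIV g" unfolding g_def by (auto intro!: continuous_intros)
  qed
  then have tr: "has_bottom_trace u g (\<lambda>x. x) {0<..<1}" by (simp add: u_def)
  have exp_int: "(\<integral>\<^sup>+y. ennreal (2 * exp (- 2 * y)) * indicator {0..} y \<partial>lborel) = ennreal (0 - (- exp (- 2 * 0)))"
  proof (rule nn_integral_FTC_atLeast)
    show "((\<lambda>y::real. - exp (- 2 * y)) \<longlongrightarrow> 0) at_top"
    proof -
      have "((\<lambda>y::real. exp (- (2 * y))) \<longlongrightarrow> 0) at_top"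
        by (rule filterlim_compose[OF exp_at_bot]) 
          (auto simp: filterlim_uminus_at_bot intro!: filterlim_tendsto_pos_mult_at_top[OF tendsto_const] filterlim_ident)
      from tendsto_minus[OF this] show ?thesis by simp
    qed
  qed (auto intro!: derivative_eq_intros)
  have "dirichlet_inf {0<..<1} \<le> (\<integral>\<^sup>+z\<in>{0<..<1} \<times> {0<..}. ennreal ((norm (g z))\<^sup>2) \<partial>lborel)"
    by (rule dirichlet_inf_le[OF tr])
  also have "\<dots> \<le> (\<integral>\<^sup>+z. (case z of (x, y) \<Rightarrow> indicator {0..1::real} x * (ennreal (2 * exp (- 2 * y)) * indicator {0..} y)) \<partial>(lborel \<Otimes>\<^sub>M lborel))"
    unfolding lborel_prod
  proof (rule nn_integral_mono)
    fix z :: "real \<times> real"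
    obtain x y where z: "z = (x, y)" by force
    show "ennreal ((norm (g z))\<^sup>2) * indicator ({0<..<1} \<times> {0<..}) z
       \<le> (case z of (x, y) \<Rightarrow> indicator {0..1} x * (ennreal (2 * exp (- 2 * y)) * indicator {0..} y))"
    proof (cases "z \<in> {0<..<1} \<times> {0<..}")
      case True
      have e2: "(exp (- y))\<^sup>2 = exp (- 2 * y)" by (simp add: exp_double[symmetric])
      have "(norm (g z))\<^sup>2 = (1 + x\<^sup>2) * exp (- 2 * y)"
        by (simp add: g_def z norm_Pair e2 power_mult_distrib algebra_simps)
      moreover have "x\<^sup>2 \<le> 1" using True z by (auto simp: power_le_one)
      ultimately have "(norm (g z))\<^sup>2 \<le> 2 * exp (- 2 * y)" by (auto intro!: mult_right_mono)
      then show ?thesis using True z by (auto simp: ennreal_leI)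
    qed simp
  qed
  also have "\<dots> = (\<integral>\<^sup>+x. \<integral>\<^sup>+y. indicator {0..1::real} x * (ennreal (2 * exp (- 2 * y)) * indicator {0..} y) \<partial>lborel \<partial>lborel)"
    by (subst lborel.nn_integral_fst[symmetric]) auto
  also have "\<dots> = (\<integral>\<^sup>+x. indicator {0..1::real} x \<partial>lborel)"
    using exp_int by (simp add: nn_integral_cmult)
  also have "\<dots> < \<infinity>" by simp
  finally show ?thesis .
qed

text \<open>Powers of the positive part supply C^1 functions with compact support without any gluing of smooth pieces: the bump
  functions below and, later, the cutoff functions on the line.\<close>

lemma DERIV_pos_part_power:
  "((\<lambda>t::real. (max 0 t) ^ (n + 2)) has_real_derivative (real n + 2) * (max 0 t) ^ (n + 1)) (at t)"
proof -
  consider "t > 0" | "t < 0" | "t = 0" by linarith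
  then show ?thesis
  proof cases
    case 1
    have "((\<lambda>t::real. t ^ (n + 2)) has_real_derivative (real n + 2) * (max 0 t) ^ (n + 1)) (at t)"
      using DERIV_pow[of "n + 2" t UNIV] 1 by (simp add: max_def add.commute)
    then show ?thesis
      by (rule has_field_derivative_transform_within_open[of _ _ _ "{0<..}"]) (use 1 in auto)
  next
    case 2
    have "((\<lambda>t::real. 0) has_real_derivative (real n + 2) * (max 0 t) ^ (n + 1)) (at t)"
      using 2 by (simp add: max_def)
    then show ?thesis
      by (rule has_field_derivative_transform_within_open[of _ _ _ "{..<0}"]) (use 2 in auto)
  next
    case 3
    have "((\<lambda>h. (max 0 h) ^ (n + 1)) \<longlongrightarrow> (max 0 0) ^ (n + 1)) (at (0::real))"
      by (intro tendsto_intros)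
    moreover have "(max 0 h) ^ (n + 2) / h = (max 0 h) ^ (n + 1)" if "h \<noteq> 0" for h :: real
      using that by (auto simp: max_def)
    ultimately have "((\<lambda>h. ((max 0 (0 + h)) ^ (n + 2) - (max 0 0) ^ (n + 2)) / h) \<longlongrightarrow> 0) (at (0::real))"
      by (auto intro: Lim_transform_eventually simp: eventually_at_filter)
    then show ?thesis using 3 by (simp add: DERIV_def)
  qed
qed

lemma DERIV_pos_part_square: 
  "((\<lambda>t::real. (max 0 t)\<^sup>2) has_real_derivative 2 * max 0 t) (at t)"
  using DERIV_pos_part_power[of 0 t] by (simp add: numeral_2_eq_2)

lemma DERIV_pos_part_cube: 
  "((\<lambda>t::real. (max 0 t) ^ 3) has_real_derivative 3 * (max 0 t)\<^sup>2) (at t)"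
  using DERIV_pos_part_power[of 1 t] by (simp add: numeral_eq_Suc)

text \<open>The vector field in the lower bound for the constant consists of products of \<open>bump\<close> and its first derivative.
  The third power makes this derivative C^1.\<close>

definition bump :: "real \<Rightarrow> real" where "bump t = (max 0 (1 - t\<^sup>2)) ^ 3"
definition bump' :: "real \<Rightarrow> real" where "bump' t = - 6 * t * (max 0 (1 - t\<^sup>2))\<^sup>2"
definition bump'' :: "real \<Rightarrow> real" where
  "bump'' t = - 6 * (max 0 (1 - t\<^sup>2))\<^sup>2 + 24 * t\<^sup>2 * max 0 (1 - t\<^sup>2)"

lemma DERIV_bump: "(bump has_real_derivative bump' t) (at t)"
proof -
  have "((\<lambda>t::real. 1 - t\<^sup>2) has_real_derivative - 2 * t) (at t)"
    by (auto intro!: derivative_eq_intros)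
  from DERIV_chain2[OF DERIV_pos_part_cube this] show ?thesis
    unfolding bump_def[abs_def] bump'_def by (simp add: algebra_simps)
qed

lemma DERIV_bump': "(bump' has_real_derivative bump'' t) (at t)"
proof -
  have "((\<lambda>t::real. 1 - t\<^sup>2) has_real_derivative - 2 * t) (at t)"
    by (auto intro!: derivative_eq_intros)
  from DERIV_chain2[OF DERIV_pos_part_square this]
  have "((\<lambda>t. (max 0 (1 - t\<^sup>2))\<^sup>2) has_real_derivative 2 * max 0 (1 - t\<^sup>2) * (- 2 * t)) (at t)" .
  moreover have "((\<lambda>t. - 6 * t) has_real_derivative - 6) (at t)"
    by (auto intro!: derivative_eq_intros)
  ultimately show ?thesis
    unfolding bump'_def[abs_def] bump''_def
    using DERIV_mult[of "\<lambda>t. - 6 * t" "- 6" t UNIV "\<lambda>t. (max 0 (1 - t\<^sup>2))\<^sup>2" "2 * max 0 (1 - t\<^sup>2) * (- 2 * t)"]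
    by (simp add: algebra_simps power2_eq_square)
qed

lemma bump_outside:
  assumes "\<bar>t\<bar> \<ge> 1" shows "bump t = 0" "bump' t = 0"
proof -
  have "1 - t\<^sup>2 \<le> 0" using assms power_mono[of 1 "\<bar>t\<bar>" 2] by simp
  then show "bump t = 0" "bump' t = 0" by (auto simp: bump_def bump'_def max_def)
qed

lemma continuous_bump:
  "continuous_on UNIV bump" "continuous_on UNIV bump'" "continuous_on UNIV bump''"
  unfolding bump_def[abs_def] bump'_def[abs_def] bump''_def[abs_def]
  by (auto intro!: continuous_intros)

lemma test_fun_product:
  fixes p p' q q' :: "real \<Rightarrow> real"
  assumes p: "\<And>t. (p has_real_derivative p' t) (at t)" and q: "\<And>t. (q has_real_derivative q' t) (at t)"
    and cont: "continuous_on UNIV p'" "continuous_on UNIV q'"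
    and supp: "\<And>t. t \<notin> {a..b} \<Longrightarrow> p t = 0" "\<And>t. t \<notin> {c..d} \<Longrightarrow> q t = 0" and sub: "{a..b} \<subseteq> \<Omega>"
  shows "test_fun (\<Omega> \<times> UNIV) (\<lambda>z. p (fst z) * q (snd z))"
    and "frechet_derivative (\<lambda>z. p (fst z) * q (snd z)) (at (x, y)) (v, w) = v * (p' x * q y) + w * (p x * q' y)"
proof -
  have D: "((\<lambda>z. p (fst z) * q (snd z)) has_derivative
      (\<lambda>v. fst v * (p' (fst z) * q (snd z)) + snd v * (p (fst z) * q' (snd z)))) (at z)" for z
  proof -
    have 1: "((\<lambda>z. p (fst z)) has_derivative (\<lambda>v. p' (fst z) * fst v)) (at z)"
      using has_derivative_compose[OF has_derivative_fst[OF has_derivative_ident] p[of "fst z", THEN has_field_derivative_imp_has_derivative]] .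
    have 2: "((\<lambda>z. q (snd z)) has_derivative (\<lambda>v. q' (snd z) * snd v)) (at z)"
      using has_derivative_compose[OF has_derivative_snd[OF has_derivative_ident] q[of "snd z", THEN has_field_derivative_imp_has_derivative]] .
    show ?thesis using has_derivative_mult[OF 1 2] by (simp add: algebra_simps)
  qed
  have fd: "frechet_derivative (\<lambda>z. p (fst z) * q (snd z)) (at z)
      = (\<lambda>v. fst v * (p' (fst z) * q (snd z)) + snd v * (p (fst z) * q' (snd z)))" for z
    using frechet_derivative_at[OF D, of z] by simp
  show "frechet_derivative (\<lambda>z. p (fst z) * q (snd z)) (at (x, y)) (v, w) = v * (p' x * q y) + w * (p x * q' y)"
    by (simp add: fd)
  have cp: "continuous_on UNIV p" "continuous_on UNIV q"
    using p q by (auto simp: continuous_on_eq_continuous_within intro: DERIV_isCont)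
  have c: "continuous_on UNIV (\<lambda>z::real\<times>real. f (fst z))" "continuous_on UNIV (\<lambda>z::real\<times>real. f (snd z))"
    if "continuous_on UNIV f" for f :: "real \<Rightarrow> real"
    by (rule continuous_on_compose2[OF that]; auto intro!: continuous_intros)+
  have cl: "closure {z. p (fst z) * q (snd z) \<noteq> 0} \<subseteq> {a..b} \<times> {c..d}"
  proof (rule closure_minimal)
    show "{z. p (fst z) * q (snd z) \<noteq> 0} \<subseteq> {a..b} \<times> {c..d}"
    proof
      fix z assume "z \<in> {z. p (fst z) * q (snd z) \<noteq> 0}"
      then have "p (fst z) \<noteq> 0" "q (snd z) \<noteq> 0" by auto
      then show "z \<in> {a..b} \<times> {c..d}" using supp[of "fst z"] supp(2)[of "snd z"]
        unfolding mem_Times_iff by blast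
    qed
  qed (intro closed_Times closed_atLeastAtMost)
  show "test_fun (\<Omega> \<times> UNIV) (\<lambda>z. p (fst z) * q (snd z))"
    unfolding test_fun_def fd
  proof (intro conjI allI ballI)
    show "(\<lambda>z. p (fst z) * q (snd z)) differentiable at x" for x
      using D unfolding differentiable_def by blast
    show "continuous_on UNIV (\<lambda>x. fst v * (p' (fst x) * q (snd x)) + snd v * (p (fst x) * q' (snd x)))" for v :: "real \<times> real"
      by (intro continuous_intros c cp cont)
    show "compact (closure {z. p (fst z) * q (snd z) \<noteq> 0})"
      using compact_Int_closed[of "{a..b} \<times> {c..d}", OF _ closed_closure[of "{z. p (fst z) * q (snd z) \<noteq> 0}"]] cl
      by (simp add: Int_absorb1 compact_Times)
    show "closure {z. p (fst z) * q (snd z) \<noteq> 0} \<subseteq> \<Omega> \<times> UNIV"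
      using cl sub by blast
  qed
qed

text \<open>Let \<open>\<psi>(x, y) = a(x) * bump y\<close> with a bump function \<open>a\<close> supported in \<open>[1/4, 3/4]\<close>. The field
  \<open>F = (\<partial>\<^sub>y\<psi>, - \<partial>\<^sub>x\<psi>)\<close> is free of divergence. Adding the trace identities for its two components eliminates \<open>u\<close> and
  leaves that, up to sign, the integral of \<open>\<nabla>u \<bullet> F\<close> is the integral \<open>T\<close> of \<open>x * a'(x)\<close>, which is minus the integral of \<open>a\<close>
  and so nonzero. The Cauchy-Schwarz inequality then bounds the energy below by \<open>T\<^sup>2\<close> over the squared norm of \<open>F\<close>.
  In the proof \<open>\<phi>1\<close> and \<open>\<phi>2\<close> denote \<open>\<partial>\<^sub>y\<psi>\<close> and \<open>\<partial>\<^sub>x\<psi>\<close>.\<close>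

lemma dirichlet_inf_unit_pos: "dirichlet_inf {0<..<1} > 0"
proof -
  define a where "a t = bump (4 * t - 2)" for t
  define a' where "a' t = 4 * bump' (4 * t - 2)" for t
  define a'' where "a'' t = 16 * bump'' (4 * t - 2)" for t
  define \<phi>1 where "\<phi>1 z = a (fst z) * bump' (snd z)" for z
  define \<phi>2 where "\<phi>2 z = a' (fst z) * bump (snd z)" for z
  have lin: "((\<lambda>t::real. 4 * t - 2) has_real_derivative 4) (at t)" for t
    by (auto intro!: derivative_eq_intros)
  have a: "(a has_real_derivative a' t) (at t)" for t
    using DERIV_chain2[OF DERIV_bump lin] unfolding a_def[abs_def] a'_def by (simp add: mult.commute)
  have a': "(a' has_real_derivative a'' t) (at t)" for t
    using DERIV_cmult[OF DERIV_chain2[OF DERIV_bump' lin], of 4] unfolding a'_def[abs_def] a''_def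
    by (simp add: mult_ac)
  have c4: "continuous_on UNIV (\<lambda>t::real. 4 * t - 2)" by (intro continuous_intros)
  have cont: "continuous_on UNIV a" "continuous_on UNIV a'" "continuous_on UNIV a''"
    unfolding a_def[abs_def] a'_def[abs_def] a''_def[abs_def]
    by (intro continuous_on_mult continuous_on_const continuous_on_compose2[OF continuous_bump(1) c4]
       continuous_on_compose2[OF continuous_bump(2) c4] continuous_on_compose2[OF continuous_bump(3) c4] subset_UNIV)+
  have a0: "a t = 0" "a' t = 0" if "t \<notin> {1/4..3/4}" for t
    using bump_outside[of "4 * t - 2"] that by (auto simp: a_def a'_def)
  have b0: "bump t = 0" "bump' t = 0" if "t \<notin> {-1..1}" for t
    using bump_outside[of t] that by auto
  have sub: "{1/4..3/4::real} \<subseteq> {0<..<1}" by auto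
  note prod1 = test_fun_product[OF a DERIV_bump' cont(2) continuous_bump(3) a0(1) b0(2) sub]
  note prod2 = test_fun_product[OF a' DERIV_bump cont(3) continuous_bump(2) a0(2) b0(1) sub]
  have \<phi>1: "test_fun ({0<..<1} \<times> UNIV) \<phi>1"
    unfolding \<phi>1_def[abs_def] by (rule prod1(1))
  have d\<phi>1: "frechet_derivative \<phi>1 (at (x, y)) (v, w) = v * (a' x * bump' y) + w * (a x * bump'' y)" for x y v w
    unfolding \<phi>1_def[abs_def] by (rule prod1(2))
  have \<phi>2: "test_fun ({0<..<1} \<times> UNIV) \<phi>2"
    unfolding \<phi>2_def[abs_def] by (rule prod2(1))
  have d\<phi>2: "frechet_derivative \<phi>2 (at (x, y)) (v, w) = v * (a'' x * bump y) + w * (a' x * bump' y)" for x y v w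
    unfolding \<phi>2_def[abs_def] by (rule prod2(2))
  let ?\<Omega> = "{0<..<1::real}"
  let ?V = "?\<Omega> \<times> {0::real<..}"
  define T where "T = (LINT x:?\<Omega>|lborel. x * \<phi>2 (x, 0))"
  have T: "T \<noteq> 0"
  proof
    assume "T = 0"
    have "T = (LINT x:{0..1}|lborel. x * a' x)"
      unfolding T_def set_lebesgue_integral_def
    proof (rule arg_cong[where f="integral\<^sup>L lborel"], rule ext)
      have "a' 0 = 0" "a' 1 = 0" by (auto intro: a0)
      then show "indicat_real {0<..<1} x *\<^sub>R (x * \<phi>2 (x, 0)) = indicat_real {0..1} x *\<^sub>R (x * a' x)" for x
        by (cases "x = 0 \<or> x = 1") (auto simp: \<phi>2_def bump_def indicator_def)
    qed
    moreover have "(LINT x:{0..1}|lborel. a x + x * a' x) = 1 * a 1 - 0 * a 0"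
      unfolding set_lebesgue_integral_def
    proof (rule integral_FTC_atLeastAtMost)
      show "((\<lambda>x. x * a x) has_vector_derivative a x + x * a' x) (at x within {0..1})" for x
        using DERIV_mult[OF DERIV_ident a, of x]
        by (auto simp: has_real_derivative_iff_has_vector_derivative[symmetric] add.commute mult.commute
            intro: has_field_derivative_at_within)
      show "continuous_on {0..1} (\<lambda>x. a x + x * a' x)"
        by (intro continuous_intros continuous_on_subset[OF cont(1)] continuous_on_subset[OF cont(2)] subset_UNIV)
    qed simp
    moreover have "(LINT x:{0..1}|lborel. a x + x * a' x) = (LINT x:{0..1}|lborel. a x) + (LINT x:{0..1}|lborel. x * a' x)"
      unfolding set_integrable_def
      by (intro set_integral_add borel_integrable_atLeastAtMost' continuous_intros
           continuous_on_subset[OF cont(1)] continuous_on_subset[OF cont(2)] subset_UNIV)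
    moreover have "a 1 = 0" using a0 by auto
    ultimately have "(LINT x:{0..1}|lborel. a x) = 0" using \<open>T = 0\<close> by simp
    moreover have "(LINT x:{0..1}|lborel. a x) = integral {0..1} a"
      by (intro set_borel_integral_eq_integral borel_integrable_atLeastAtMost' continuous_on_subset[OF cont(1)]) auto
    ultimately have "\<forall>x\<in>{0..1}. a x = 0"
      using integral_eq_0_iff[of 0 1 a] continuous_on_subset[OF cont(1), of "{0..1}"]
      by (auto simp: a_def bump_def)
    then have "a (1/2) = 0" by simp
    then show False by (simp add: a_def bump_def)
  qed
  define B where "B = (\<integral>z. (\<phi>1 z)\<^sup>2 + (\<phi>2 z)\<^sup>2 \<partial>lborel)"
  have cphi: "continuous_on UNIV \<phi>1" "continuous_on UNIV \<phi>2" using \<phi>1 \<phi>2 test_fun_continuous by blast+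
  have intB: "integrable lborel (\<lambda>z. (\<phi>1 z)\<^sup>2 + (\<phi>2 z)\<^sup>2)"
    using integrable_test_fun(1)[OF \<phi>1 cphi(1)] integrable_test_fun(1)[OF \<phi>2 cphi(2)]
    by (auto simp: power2_eq_square)
  have B: "B \<ge> 0" unfolding B_def by simp
  have "ennreal (T\<^sup>2 / (B + 1)) \<le> dirichlet_inf ?\<Omega>"
  proof (rule le_dirichlet_inf)
    fix u g assume tr: "has_bottom_trace u g (\<lambda>x. x) ?\<Omega>"
    let ?N = "\<integral>\<^sup>+z\<in>?V. ennreal ((norm (g z))\<^sup>2) \<partial>lborel"
    show "ennreal (T\<^sup>2 / (B + 1)) \<le> ?N"
    proof (cases "?N = \<infinity>")
      case False
      have V: "?V \<in> sets lborel" by (auto intro!: borel_open open_Times)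
      define f where "f z = (norm (g z))\<^sup>2 * indicator ?V z" for z
      have f_eq: "ennreal (f z) = ennreal ((norm (g z))\<^sup>2) * indicator ?V z" for z
        by (auto simp: f_def indicator_def)
      have fm: "f \<in> borel_measurable borel"
      proof -
        have "(\<lambda>z. enn2real (ennreal ((norm (g z))\<^sup>2) * indicator ?V z)) \<in> borel_measurable borel"
          using energy_density_measurable[OF tr] by measurable
        moreover have "f z = enn2real (ennreal ((norm (g z))\<^sup>2) * indicator ?V z)" for z
          by (simp add: f_eq[symmetric]) (simp add: f_def)
        ultimately show ?thesis by presburger
      qed
      have fint: "integrable lborel f"
      proof (rule integrableI_nonneg)
        show "(\<integral>\<^sup>+z. ennreal (f z) \<partial>lborel) < \<infinity>"
          using False unfolding f_eq by (simp add: less_top)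
      qed (use fm in \<open>auto simp: f_def\<close>)
      define E where "E = integral\<^sup>L lborel f"
      have E: "?N = ennreal E"
        unfolding E_def f_eq[symmetric] by (rule nn_integral_eq_integral[OF fint]) (auto simp: f_def)
      have locint: "loc_integrable (?\<Omega> \<times> {0..}) u" "loc_integrable (?\<Omega> \<times> {0..}) g"
        using tr by (auto simp: has_bottom_trace_def)
      let ?K = "{1/4..3/4::real} \<times> {-1..1::real}"
      have K: "compact ?K" "?K \<subseteq> ?\<Omega> \<times> UNIV" by (auto intro: compact_Times)
      have locg: "loc_integrable (?\<Omega> \<times> {0..}) (\<lambda>z. g z \<bullet> b)" for b
        unfolding loc_integrable_def set_integrable_def
      proof (intro allI impI)
        fix K assume "compact K \<and> K \<subseteq> ?\<Omega> \<times> {0::real..}"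
        then have "integrable lborel (\<lambda>z. indicator K z *\<^sub>R g z)"
          using locint(2) unfolding loc_integrable_def set_integrable_def by blast
        from integrable_inner_left[OF this, of b]
        show "integrable lborel (\<lambda>z. indicator K z *\<^sub>R (g z \<bullet> b))" by simp
      qed
      have green: "(LINT z:?V|lborel. u z * frechet_derivative \<phi> (at z) b)
          = - (LINT z:?V|lborel. (g z \<bullet> b) * \<phi> z)
            + ((0, -1) \<bullet> b) * (LINT x:?\<Omega>|lborel. x * \<phi> (x, 0))"
        if "test_fun (?\<Omega> \<times> UNIV) \<phi>" "b \<in> Basis" for \<phi> b
        using tr that unfolding has_bottom_trace_def by blast
      have "frechet_derivative \<phi>1 (at z) (1, 0) = a' (fst z) * bump' (snd z)"
        and "frechet_derivative \<phi>2 (at z) (0, 1) = a' (fst z) * bump' (snd z)" for z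
        using d\<phi>1[where x="fst z" and y="snd z"] d\<phi>2[where x="fst z" and y="snd z"] by simp_all
      then have G1: "(LINT z:?V|lborel. u z * (a' (fst z) * bump' (snd z))) = - (LINT z:?V|lborel. (g z \<bullet> (1, 0)) * \<phi>1 z)"
        and G2: "(LINT z:?V|lborel. u z * (a' (fst z) * bump' (snd z))) = - (LINT z:?V|lborel. (g z \<bullet> (0, 1)) * \<phi>2 z) - T"
        using green[OF \<phi>1, of "(1, 0)"] green[OF \<phi>2, of "(0, 1)"]
        by (simp_all add: T_def Basis_prod_def)
      have i1: "set_integrable lborel ?V (\<lambda>z. (g z \<bullet> (1, 0)) * \<phi>1 z)"
        by (rule set_integrable_upper_half[OF locg K cphi(1)]) (use a0 b0 in \<open>auto simp: \<phi>1_def mem_Times_iff\<close>)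
      have i2: "set_integrable lborel ?V (\<lambda>z. (g z \<bullet> (0, 1)) * \<phi>2 z)"
        by (rule set_integrable_upper_half[OF locg K cphi(2)]) (use a0 b0 in \<open>auto simp: \<phi>2_def mem_Times_iff\<close>)
      have T_eq: "T = (LINT z:?V|lborel. (g z \<bullet> (1, 0)) * \<phi>1 z - (g z \<bullet> (0, 1)) * \<phi>2 z)"
        using G1 G2 set_integral_diff(2)[OF i1 i2] by simp
      \<comment> \<open>The Cauchy-Schwarz inequality appears as Young's inequality with an optimal weight. Using \<open>B + 1\<close> instead of
        \<open>B\<close> keeps the weight positive without showing that \<open>F\<close> is nonzero.\<close>
      define s where "s = (B + 1) / \<bar>T\<bar>"
      have s: "s > 0" using T B by (simp add: s_def)
      have "\<bar>T\<bar> \<le> (\<integral>z. \<bar>indicator ?V z *\<^sub>R ((g z \<bullet> (1, 0)) * \<phi>1 z - (g z \<bullet> (0, 1)) * \<phi>2 z)\<bar> \<partial>lborel)"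
        unfolding T_eq set_lebesgue_integral_def by (rule integral_abs_bound)
      also have "\<dots> \<le> (\<integral>z. (s * f z + ((\<phi>1 z)\<^sup>2 + (\<phi>2 z)\<^sup>2) / s) / 2 \<partial>lborel)"
      proof (rule integral_mono)
        show "integrable lborel (\<lambda>z. \<bar>indicator ?V z *\<^sub>R ((g z \<bullet> (1, 0)) * \<phi>1 z - (g z \<bullet> (0, 1)) * \<phi>2 z)\<bar>)"
          using set_integral_diff(1)[OF i1 i2] unfolding set_integrable_def by (rule integrable_abs)
        show "integrable lborel (\<lambda>z. (s * f z + ((\<phi>1 z)\<^sup>2 + (\<phi>2 z)\<^sup>2) / s) / 2)"
          using fint intB by simp
        show "\<bar>indicator ?V z *\<^sub>R ((g z \<bullet> (1, 0)) * \<phi>1 z - (g z \<bullet> (0, 1)) * \<phi>2 z)\<bar>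
            \<le> (s * f z + ((\<phi>1 z)\<^sup>2 + (\<phi>2 z)\<^sup>2) / s) / 2" for z
        proof (cases "z \<in> ?V")
          case True
          obtain p q where g: "g z = (p, q)" by force
          have yng: "2 * \<bar>k * w\<bar> \<le> s * k\<^sup>2 + w\<^sup>2 / s" for k w :: real
          proof -
            have "0 \<le> (s * \<bar>k\<bar> - \<bar>w\<bar>)\<^sup>2" by simp
            then have "2 * s * \<bar>k * w\<bar> \<le> s * (s * k\<^sup>2) + w\<^sup>2"
              by (simp add: power2_diff power_mult_distrib abs_mult algebra_simps power2_eq_square)
            then show ?thesis using s by (simp add: field_simps)
          qed
          have "f z = p\<^sup>2 + q\<^sup>2" using True by (simp add: f_def g norm_Pair)
          then show ?thesis using True yng[of p "\<phi>1 z"] yng[of q "\<phi>2 z"]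
            by (simp add: g algebra_simps add_divide_distrib)
        next
          case False
          then show ?thesis using s by (simp add: f_def)
        qed
      qed
      also have "\<dots> = (s * E + B / s) / 2"
        unfolding E_def B_def using fint intB by simp
      also have "\<dots> \<le> (s * E + \<bar>T\<bar>) / 2"
      proof -
        have "B / s = \<bar>T\<bar> * (B / (B + 1))" using T B by (simp add: s_def)
        also have "\<dots> \<le> \<bar>T\<bar> * 1" using B by (intro mult_left_mono) auto
        finally show ?thesis by (intro divide_right_mono add_left_mono) auto
      qed
      finally have "\<bar>T\<bar> \<le> s * E" by simp
      then have "\<bar>T\<bar> * \<bar>T\<bar> \<le> (B + 1) * E" using T by (simp add: s_def field_simps)
      then have "T\<^sup>2 / (B + 1) \<le> E" using B by (simp add: power2_eq_square field_simps)
      then show ?thesis unfolding E by (rule ennreal_leI)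
    qed simp
  qed
  moreover have "0 < T\<^sup>2 / (B + 1)" using T B by simp
  ultimately show ?thesis by (meson ennreal_less_zero_iff less_le_trans)
qed

lemma dirichlet_inf_unit: "dirichlet_inf {0<..<1} = ennreal C_W" and C_W_pos: "C_W > 0"
  using dirichlet_inf_unit_finite dirichlet_inf_unit_pos
  by (auto simp: C_W_def enn2real_positive_iff)

section \<open>Behaviour under translations and dilations\<close>

lemma nn_integral_affine:
  fixes t :: "'a::euclidean_space"
  assumes [measurable]: "f \<in> borel_measurable borel" and c: "c \<noteq> 0"
  shows "(\<integral>\<^sup>+z. f z \<partial>lborel) = ennreal (\<bar>c\<bar> ^ DIM('a)) * (\<integral>\<^sup>+z. f (t + c *\<^sub>R z) \<partial>lborel)"
  by (subst lborel_affine[OF c, of t])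
     (simp add: nn_integral_density nn_integral_distr nn_integral_cmult)

lemma integrable_affine:
  fixes f :: "'a::euclidean_space \<Rightarrow> 'b::{banach, second_countable_topology}"
  assumes f: "integrable lborel f" and c: "c \<noteq> 0"
  shows "integrable lborel (\<lambda>z. f (t + c *\<^sub>R z))"
  using f f[THEN borel_measurable_integrable] unfolding integrable_iff_bounded
  by (subst (asm) nn_integral_affine[where c=c and t=t]) (auto simp: ennreal_mult_less_top c)

lemma integrable_affine_iff:
  fixes f :: "'a::euclidean_space \<Rightarrow> 'b::{banach, second_countable_topology}"
  assumes c: "c \<noteq> 0"
  shows "integrable lborel (\<lambda>z. f (t + c *\<^sub>R z)) \<longleftrightarrow> integrable lborel f"
  using integrable_affine[of f c t] integrable_affine[of "\<lambda>z. f (t + c *\<^sub>R z)" "1/c" "(-1/c) *\<^sub>R t"] c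
  by (auto simp: scaleR_diff_right)

lemma integral_affine:
  fixes f :: "'a::euclidean_space \<Rightarrow> 'b::{banach, second_countable_topology}"
  assumes c: "c \<noteq> 0"
  shows "(\<integral>z. f z \<partial>lborel) = (\<bar>c\<bar> ^ DIM('a)) *\<^sub>R (\<integral>z. f (t + c *\<^sub>R z) \<partial>lborel)"
proof cases
  assume f[measurable]: "integrable lborel f"
  then show ?thesis
    using c f f[THEN borel_measurable_integrable] integrable_affine[OF f c, of t]
    by (subst lborel_affine[OF c, of t])
       (simp add: integral_density integral_distr)
next
  assume "\<not> integrable lborel f"
  with c show ?thesis by (simp add: integrable_affine_iff not_integrable_integral_eq)
qed

lemma test_fun_affine:
  fixes \<phi> :: "'a::euclidean_space \<Rightarrow> real"
  assumes \<phi>: "test_fun U \<phi>" and c: "c \<noteq> 0"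
  shows "test_fun {z. t + c *\<^sub>R z \<in> U} (\<lambda>z. \<phi> (t + c *\<^sub>R z))"
    and "frechet_derivative (\<lambda>z. \<phi> (t + c *\<^sub>R z)) (at z) b = c * frechet_derivative \<phi> (at (t + c *\<^sub>R z)) b"
proof -
  have D: "((\<lambda>z. \<phi> (t + c *\<^sub>R z)) has_derivative (\<lambda>b. c * frechet_derivative \<phi> (at (t + c *\<^sub>R z)) b)) (at z)" for z
  proof -
    have d: "\<phi> differentiable at (t + c *\<^sub>R z)" by (rule test_fun_differentiable[OF \<phi>])
    have "((\<lambda>z. t + c *\<^sub>R z) has_derivative (\<lambda>b. c *\<^sub>R b)) (at z)"
      by (auto intro!: derivative_eq_intros)
    from has_derivative_compose[OF this d[unfolded frechet_derivative_works]]
    show ?thesis using linear_cmul[OF linear_frechet_derivative[OF d]] by simp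
  qed
  show eq: "frechet_derivative (\<lambda>z. \<phi> (t + c *\<^sub>R z)) (at z) b = c * frechet_derivative \<phi> (at (t + c *\<^sub>R z)) b" for z b
    using fun_cong[OF frechet_derivative_at[OF D, of z], of b] by simp
  have aff: "continuous_on UNIV (\<lambda>z. t + c *\<^sub>R z)" by (intro continuous_intros)
  let ?S = "closure {z. \<phi> z \<noteq> 0}"
  let ?T = "(\<lambda>w. (1 / c) *\<^sub>R (w - t)) ` ?S"
  have comp: "compact ?T" 
    using \<phi> unfolding test_fun_def by (intro compact_continuous_image continuous_intros) auto
  have sub: "closure {z. \<phi> (t + c *\<^sub>R z) \<noteq> 0} \<subseteq> ?T"
  proof (rule closure_minimal)
    show "{z. \<phi> (t + c *\<^sub>R z) \<noteq> 0} \<subseteq> ?T"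
    proof
      fix z assume "z \<in> {z. \<phi> (t + c *\<^sub>R z) \<noteq> 0}"
      then have "t + c *\<^sub>R z \<in> ?S" using closure_subset[of "{z. \<phi> z \<noteq> 0}"] by blast
      then show "z \<in> ?T" using c by (intro image_eqI[of _ _ "t + c *\<^sub>R z"]) auto
    qed
    show "closed ?T" using comp by (rule compact_imp_closed)
  qed
  show "test_fun {z. t + c *\<^sub>R z \<in> U} (\<lambda>z. \<phi> (t + c *\<^sub>R z))"
    unfolding test_fun_def eq
  proof (intro conjI allI ballI)
    show "(\<lambda>z. \<phi> (t + c *\<^sub>R z)) differentiable at x" for x
      using D unfolding differentiable_def by blast
    show "continuous_on UNIV (\<lambda>x. c * frechet_derivative \<phi> (at (t + c *\<^sub>R x)) b)" if "b \<in> Basis" for b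
      by (intro continuous_on_mult continuous_on_const
          continuous_on_compose2[OF test_fun_continuous_deriv[OF \<phi> that] aff]) auto
    show "compact (closure {z. \<phi> (t + c *\<^sub>R z) \<noteq> 0})"
      using compact_Int_closed[OF comp closed_closure[of "{z. \<phi> (t + c *\<^sub>R z) \<noteq> 0}"]] sub
      by (simp add: Int_absorb1)
    have "?S \<subseteq> U" using \<phi> unfolding test_fun_def by blast
    then have "?T \<subseteq> {z. t + c *\<^sub>R z \<in> U}" using c by auto
    then show "closure {z. \<phi> (t + c *\<^sub>R z) \<noteq> 0} \<subseteq> {z. t + c *\<^sub>R z \<in> U}" using sub by blast
  qed
qed

lemma loc_integrable_affine:
  fixes u :: "'a::euclidean_space \<Rightarrow> 'b::euclidean_space"
  assumes u: "loc_integrable S u" and c: "c \<noteq> 0"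
  shows "loc_integrable {z. t + c *\<^sub>R z \<in> S} (\<lambda>z. u (t + c *\<^sub>R z))"
  unfolding loc_integrable_def
proof (intro allI impI)
  fix K assume K: "compact K \<and> K \<subseteq> {z. t + c *\<^sub>R z \<in> S}"
  let ?K = "(\<lambda>z. t + c *\<^sub>R z) ` K"
  have "compact ?K" using K by (intro compact_continuous_image continuous_intros) auto
  moreover have "?K \<subseteq> S" using K by auto
  ultimately have "integrable lborel (\<lambda>z. indicator ?K z *\<^sub>R u z)"
    using u by (auto simp: loc_integrable_def set_integrable_def)
  from integrable_affine[OF this c, of t]
  have "integrable lborel (\<lambda>z. indicator ?K (t + c *\<^sub>R z) *\<^sub>R u (t + c *\<^sub>R z))" .
  moreover have "indicator ?K (t + c *\<^sub>R z) = (indicator K z :: real)" for z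
    using c by (auto simp: indicator_def)
  ultimately show "set_integrable lborel K (\<lambda>z. u (t + c *\<^sub>R z))" by (simp add: set_integrable_def)
qed

text \<open>The dilated competitor has trace \<open>t + c * ((x - t) / c) = x\<close>. The dilation part of the trace identity is the original
  identity for the dilated test function. The constant \<open>t\<close> contributes Green's formula for constants, which accounts for
  the difference between \<open>x - t\<close> and \<open>x\<close> on the boundary.\<close>

lemma has_bottom_trace_affine:
  fixes t c :: real
  assumes tr: "has_bottom_trace u g (\<lambda>x. x) \<Omega>" and c: "c > 0"
  shows "has_bottom_trace (\<lambda>z. t + c * u ((-t/c, 0) + (1/c) *\<^sub>R z)) (\<lambda>z. g ((-t/c, 0) + (1/c) *\<^sub>R z)) (\<lambda>x. x)
           {x. (x - t) / c \<in> \<Omega>}"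
proof -
  let ?A = "\<lambda>z. (-t/c, 0) + (1/c) *\<^sub>R (z :: real \<times> real)"
  let ?B = "\<lambda>z. (t, 0) + c *\<^sub>R (z :: real \<times> real)"
  let ?\<Omega>' = "{x. (x - t) / c \<in> \<Omega>}"
  let ?V = "\<Omega> \<times> {0::real<..}" and ?V' = "?\<Omega>' \<times> {0::real<..}"
  have AB: "?A (?B z) = z" for z using c by (cases z) (simp add: field_simps)
  have set_eq: "{z. ?A z \<in> \<Omega> \<times> {0..}} = ?\<Omega>' \<times> {0..}"
    using c by (auto simp: diff_divide_distrib zero_le_divide_iff)
  have locu: "loc_integrable (?\<Omega>' \<times> {0..}) (\<lambda>z. u (?A z))" and locg: "loc_integrable (?\<Omega>' \<times> {0..}) (\<lambda>z. g (?A z))"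
    using loc_integrable_affine[of "\<Omega> \<times> {0..}" u "1/c" "(-t/c,0)"] loc_integrable_affine[of "\<Omega> \<times> {0..}" g "1/c" "(-t/c,0)"]
      tr c unfolding set_eq has_bottom_trace_def by auto
  have loc1: "loc_integrable (?\<Omega>' \<times> {0..}) (\<lambda>z. t)"
    by (intro continuous_imp_loc_integrable continuous_intros)
  show ?thesis
    unfolding has_bottom_trace_def
  proof (intro conjI allI impI ballI)
    show "loc_integrable (?\<Omega>' \<times> {0..}) (\<lambda>z. g (?A z))" by (rule locg)
    show "loc_integrable (?\<Omega>' \<times> {0..}) (\<lambda>z. t + c * u (?A z))"
      using locu loc1 unfolding loc_integrable_def by (auto intro!: set_integral_add)
    fix \<phi> :: "real \<times> real \<Rightarrow> real" and b :: "real \<times> real"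
    assume \<phi>: "test_fun (?\<Omega>' \<times> UNIV) \<phi>" and b: "b \<in> Basis"
    let ?d = "\<lambda>z. frechet_derivative \<phi> (at z) b"
    let ?K = "closure {z. \<phi> z \<noteq> 0}"
    let ?n = "(0, -1) \<bullet> b"
    have ind: "indicat_real ?V' (?B z) = indicat_real ?V z" for z
      using c by (cases z) (auto simp: indicator_def zero_less_mult_iff)
    have cov: "(LINT z:?V'|lborel. k (?A z) * w z) = c\<^sup>2 * (LINT z:?V|lborel. k z * w (?B z))" for k w :: "real \<times> real \<Rightarrow> real"
    proof -
      have "(LINT z:?V'|lborel. k (?A z) * w z)
          = c\<^sup>2 * (\<integral>z. indicator ?V' (?B z) *\<^sub>R (k (?A (?B z)) * w (?B z)) \<partial>lborel)"
        unfolding set_lebesgue_integral_def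
        by (subst integral_affine[of c _ "(t, 0)"]) (use c in \<open>auto simp: power2_eq_square\<close>)
      then show ?thesis unfolding AB ind set_lebesgue_integral_def .
    qed
    have cov1: "(LINT x:?\<Omega>'|lborel. k x * \<phi> (x, 0)) = c * (LINT x:\<Omega>|lborel. k (t + c * x) * \<phi> (t + c * x, 0))" for k :: "real \<Rightarrow> real"
    proof -
      have "indicat_real ?\<Omega>' (t + c * x) = indicat_real \<Omega> x" for x using c by (simp add: indicator_def)
      then show ?thesis unfolding set_lebesgue_integral_def
        by (subst lborel_integral_real_affine[of c _ t]) (use c in auto)
    qed
    have "{z. ?B z \<in> ?\<Omega>' \<times> UNIV} = \<Omega> \<times> UNIV" using c by auto
    then have \<phi>': "test_fun (\<Omega> \<times> UNIV) (\<lambda>z. \<phi> (?B z))"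
      using test_fun_affine(1)[OF \<phi>, of c "(t,0)"] c by simp
    have d': "frechet_derivative (\<lambda>z. \<phi> (?B z)) (at z) b = c * ?d (?B z)" for z
      using test_fun_affine(2)[OF \<phi>, of c "(t,0)"] c by simp
    have main: "(LINT z:?V|lborel. u z * (c * ?d (?B z))) = - (LINT z:?V|lborel. (g z \<bullet> b) * \<phi> (?B z))
            + ?n * (LINT x:\<Omega>|lborel. x * \<phi> (?B (x, 0)))"
      using tr \<phi>' b unfolding has_bottom_trace_def d'[symmetric] by blast
    have const: "(LINT z:?V'|lborel. 1 * ?d z) = - (LINT z:?V'|lborel. (0 \<bullet> b) * \<phi> z)
            + ?n * (LINT x:?\<Omega>'|lborel. 1 * \<phi> (x, 0))"
      using has_bottom_trace_C1[of "\<lambda>_. 1" "\<lambda>_. 0" ?\<Omega>'] \<phi> b unfolding has_bottom_trace_def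
      by (simp add: continuous_on_const)
    have compK: "compact ?K" "?K \<subseteq> ?\<Omega>' \<times> UNIV" using \<phi> by (auto simp: test_fun_def)
    have int: "set_integrable lborel ?V' (\<lambda>z. k z * ?d z)" if "loc_integrable (?\<Omega>' \<times> {0..}) k" for k
      by (rule set_integrable_upper_half[OF that compK test_fun_continuous_deriv[OF \<phi> b]])
         (rule frechet_derivative_outside_support)
    have int1: "set_integrable lborel ?\<Omega>' (\<lambda>x. k x * \<phi> (x, 0))" if "continuous_on UNIV k" for k
    proof -
      have "integrable lborel (\<lambda>x. k x * \<phi> (x, 0))"
      proof (rule integrable_continuous_compact_support)
        show "compact (fst ` ?K)" by (intro compact_continuous_image compK continuous_intros)
        show "continuous_on UNIV (\<lambda>x. k x * \<phi> (x, 0))"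
          by (intro continuous_on_mult that continuous_on_compose2[OF test_fun_continuous[OF \<phi>]] continuous_intros) auto
        show "k x * \<phi> (x, 0) = 0" if "x \<notin> fst ` ?K" for x
          using that closure_subset[of "{z. \<phi> z \<noteq> 0}"] by force
      qed
      moreover have "indicator ?\<Omega>' x *\<^sub>R (k x * \<phi> (x, 0)) = k x * \<phi> (x, 0)" for x
        using test_fun_support(1)[OF \<phi>, of "(x, 0)"] by (auto simp: indicator_def)
      ultimately show ?thesis unfolding set_integrable_def by presburger
    qed
    have "(LINT z:?V'|lborel. (t + c * u (?A z)) * ?d z)
        = (LINT z:?V'|lborel. t * ?d z + c * u (?A z) * ?d z)" by (simp add: algebra_simps)
    also have "\<dots> = t * (LINT z:?V'|lborel. 1 * ?d z) + c * (LINT z:?V'|lborel. u (?A z) * ?d z)"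
      using set_integral_add(2)[OF int[OF loc1] set_integrable_mult_right[OF int[OF locu], of c]]
      by (simp add: mult.assoc)
    also have "(LINT z:?V'|lborel. u (?A z) * ?d z) = c * (LINT z:?V|lborel. u z * (c * ?d (?B z)))"
      using cov[of u ?d] by (simp add: power2_eq_square mult.left_commute mult.assoc)
    also have "c * (c * (LINT z:?V|lborel. u z * (c * ?d (?B z)))) 
       = - (LINT z:?V'|lborel. (g (?A z) \<bullet> b) * \<phi> z) + ?n * (c * (LINT x:\<Omega>|lborel. c * x * \<phi> (t + c * x, 0)))"
    proof -
      have "(LINT x:\<Omega>|lborel. c * x * \<phi> (t + c * x, 0)) = c * (LINT x:\<Omega>|lborel. x * \<phi> (?B (x, 0)))"
        by (simp add: mult.assoc)
      then show ?thesis
        unfolding main cov[of "\<lambda>z. g z \<bullet> b"] by (simp only: power2_eq_square) (simp add: algebra_simps)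
    qed
    also have "c * (LINT x:\<Omega>|lborel. c * x * \<phi> (t + c * x, 0)) = (LINT x:?\<Omega>'|lborel. (x - t) * \<phi> (x, 0))"
      unfolding cov1 by simp
    also have "\<dots> = (LINT x:?\<Omega>'|lborel. x * \<phi> (x, 0)) - t * (LINT x:?\<Omega>'|lborel. \<phi> (x, 0))"
      using set_integral_diff(2)[OF int1[of "\<lambda>x. x"] int1[of "\<lambda>x. t"]]
      by (simp add: algebra_simps continuous_on_id)
    finally show "(LINT z:?V'|lborel. (t + c * u (?A z)) * ?d z)
          = - (LINT z:?V'|lborel. (g (?A z) \<bullet> b) * \<phi> z)
            + ?n * (LINT x:?\<Omega>'|lborel. x * \<phi> (x, 0))"
      unfolding const by (simp add: algebra_simps)
  qed
qed

text \<open>In the plane the energy picks up the factor \<open>c\<^sup>2\<close> from the area, because the gradient of \<open>c * u(z / c)\<close> is an unscaled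
  copy of the gradient of \<open>u\<close>.\<close>

lemma dirichlet_inf_affine_le:
  assumes \<Omega>: "open \<Omega>" and c: "c > 0"
  shows "dirichlet_inf {x. (x - t) / c \<in> \<Omega>} \<le> ennreal (c\<^sup>2) * dirichlet_inf \<Omega>"
proof -
  let ?\<Omega>' = "{x. (x - t) / c \<in> \<Omega>}"
  have "ennreal (1 / c\<^sup>2) * dirichlet_inf ?\<Omega>' \<le> dirichlet_inf \<Omega>"
  proof (rule le_dirichlet_inf)
    fix u g assume tr: "has_bottom_trace u g (\<lambda>x. x) \<Omega>"
    let ?A = "\<lambda>z. (-t/c, 0) + (1/c) *\<^sub>R (z :: real \<times> real)"
    let ?f = "\<lambda>z. ennreal ((norm (g z))\<^sup>2) * indicator (\<Omega> \<times> {0<..}) z"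
    have m: "?f \<in> borel_measurable borel" by (rule energy_density_measurable[OF tr \<Omega>])
    have "dirichlet_inf ?\<Omega>' \<le> (\<integral>\<^sup>+z\<in>?\<Omega>' \<times> {0<..}. ennreal ((norm (g (?A z)))\<^sup>2) \<partial>lborel)"
      by (rule dirichlet_inf_le[OF has_bottom_trace_affine[OF tr c]])
    also have "\<dots> = (\<integral>\<^sup>+z. ?f (?A z) \<partial>lborel)"
    proof (rule nn_integral_cong)
      fix z :: "real \<times> real"
      have "z \<in> ?\<Omega>' \<times> {0<..} \<longleftrightarrow> ?A z \<in> \<Omega> \<times> {0<..}"
        using c by (cases z) (simp add: diff_divide_distrib add.commute zero_less_divide_iff)
      then show "ennreal ((norm (g (?A z)))\<^sup>2) * indicator (?\<Omega>' \<times> {0<..}) z = ?f (?A z)"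
        by (simp add: indicator_def)
    qed
    finally have "ennreal (1 / c\<^sup>2) * dirichlet_inf ?\<Omega>' \<le> ennreal (1 / c\<^sup>2) * (\<integral>\<^sup>+z. ?f (?A z) \<partial>lborel)"
      by (rule mult_left_mono) simp
    also have "\<dots> = (\<integral>\<^sup>+z. ?f z \<partial>lborel)"
      using nn_integral_affine[OF m, of "1/c" "(-t/c, 0)"] c by (simp add: power_divide power2_eq_square)
    finally show "ennreal (1 / c\<^sup>2) * dirichlet_inf ?\<Omega>' \<le> (\<integral>\<^sup>+z. ?f z \<partial>lborel)" .
  qed
  then have "ennreal (c\<^sup>2) * (ennreal (1 / c\<^sup>2) * dirichlet_inf ?\<Omega>') \<le> ennreal (c\<^sup>2) * dirichlet_inf \<Omega>"
    by (rule mult_left_mono) simp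
  also have "ennreal (c\<^sup>2) * (ennreal (1 / c\<^sup>2) * dirichlet_inf ?\<Omega>') = dirichlet_inf ?\<Omega>'"
    using c by (simp add: mult.assoc[symmetric] ennreal_mult[symmetric])
  finally show ?thesis .
qed

text \<open>Both inequalities come from \<open>dirichlet_inf_affine_le\<close>, applied to the map from the unit interval and to its inverse.\<close>

lemma dirichlet_inf_interval:
  assumes "a < b"
  shows "dirichlet_inf {a<..<b} = ennreal (C_W * (b - a)\<^sup>2)"
proof (rule antisym)
  let ?L = "b - a"
  have L: "?L > 0" using assms by simp
  have "{x. (x - a) / ?L \<in> {0<..<1}} = {a<..<b}" using L by (auto simp: field_simps)
  with dirichlet_inf_affine_le[of "{0<..<1}" ?L a] L
  show "dirichlet_inf {a<..<b} \<le> ennreal (C_W * ?L\<^sup>2)"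
    by (simp add: dirichlet_inf_unit ennreal_mult[symmetric] C_W_pos less_imp_le mult.commute)
  have "(x - (- a / ?L)) / (1 / ?L) = x * ?L + a" for x using L by (simp add: field_simps)
  moreover have "{x. x * ?L + a \<in> {a<..<b}} = {0<..<1}"
  proof -
    have "x * ?L + a < b \<longleftrightarrow> x * ?L < 1 * ?L" "a < x * ?L + a \<longleftrightarrow> 0 * ?L < x * ?L" for x by auto
    then show ?thesis unfolding greaterThanLessThan_iff mult_less_cancel_right_pos[OF L] by auto
  qed
  ultimately have "{x. (x - (- a / ?L)) / (1 / ?L) \<in> {a<..<b}} = {0<..<1}" by simp
  with dirichlet_inf_affine_le[of "{a<..<b}" "1 / ?L" "- a / ?L"] L
  have "ennreal C_W \<le> ennreal ((1 / ?L)\<^sup>2) * dirichlet_inf {a<..<b}"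
    by (simp add: dirichlet_inf_unit)
  then have "ennreal (?L\<^sup>2) * ennreal C_W \<le> ennreal (?L\<^sup>2) * (ennreal ((1 / ?L)\<^sup>2) * dirichlet_inf {a<..<b})"
    by (rule mult_left_mono) simp
  also have "\<dots> = dirichlet_inf {a<..<b}"
    using L by (simp add: mult.assoc[symmetric] ennreal_mult[symmetric] power_one_over)
  finally show "ennreal (C_W * ?L\<^sup>2) \<le> dirichlet_inf {a<..<b}"
    by (simp add: ennreal_mult[symmetric] C_W_pos less_imp_le mult.commute)
qed

text \<open>An unbounded interval contains intervals of every length, each of which bounds the infimum from below.\<close>

lemma dirichlet_inf_unbounded:
  assumes "is_interval I" "\<not> bounded I"
  shows "dirichlet_inf I = \<infinity>"
proof -
  obtain x0 where x0: "x0 \<in> I" using assms(2) by (metis bounded_empty ex_in_conv)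
  have "ennreal (C_W * L\<^sup>2) \<le> dirichlet_inf I" if L: "L > 0" for L
  proof -
    obtain y where y: "y \<in> I" "\<bar>y - x0\<bar> > L"
      proof -
      have "\<not> (\<forall>y\<in>I. dist x0 y \<le> L)" using assms(2) unfolding bounded_def by blast
      then show thesis using that by (auto simp: dist_real_def abs_minus_commute not_le)
    qed
    let ?a = "min x0 y" and ?b = "max x0 y"
    have "{?a<..<?b} \<subseteq> I"
    proof
      fix z assume "z \<in> {?a<..<?b}"
      moreover have "?a \<in> I" "?b \<in> I" using x0 y(1) by (simp_all add: min_def max_def)
      ultimately show "z \<in> I"
        using mem_is_interval_1_I[OF assms(1), of ?a ?b z] by (simp add: less_imp_le)
    qed
    then have "dirichlet_inf {?a<..<?b} \<le> dirichlet_inf I" by (rule dirichlet_inf_mono)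
    moreover have "?a < ?b" "L \<le> ?b - ?a" using y(2) L by auto
    moreover have "C_W * L\<^sup>2 \<le> C_W * (?b - ?a)\<^sup>2"
      using C_W_pos L \<open>L \<le> ?b - ?a\<close> by (intro mult_left_mono power_mono) auto
    ultimately show ?thesis by (simp add: dirichlet_inf_interval) (meson ennreal_leI order_trans)
  qed
  note * = this
  have "of_nat n \<le> dirichlet_inf I" for n :: nat
  proof -
    define L where "L = sqrt ((real n + 1) / C_W)"
    have "L > 0" "C_W * L\<^sup>2 = real n + 1" using C_W_pos by (simp_all add: L_def)
    with *[of L] have "ennreal (real n + 1) \<le> dirichlet_inf I" by simp
    moreover have "of_nat n \<le> ennreal (real n + 1)"
      unfolding ennreal_of_nat_eq_real_of_nat by (rule ennreal_leI) simp
    ultimately show ?thesis by (rule order_trans[rotated])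
  qed
  then have "\<not> dirichlet_inf I < top"
    using ennreal_Ex_less_of_nat[of "dirichlet_inf I"] by (auto simp: not_less[symmetric])
  then show ?thesis by (simp add: less_top[symmetric])
qed

section \<open>Integration by parts for weak derivatives on the line\<close>

lemma test_fun_real:
  assumes D: "\<And>x. (\<phi> has_real_derivative \<phi>' x) (at x)" and cont: "continuous_on UNIV \<phi>'"
    and supp: "\<And>x. x \<notin> {a..b} \<Longrightarrow> \<phi> x = 0"
  shows "test_fun UNIV \<phi>" and "frechet_derivative \<phi> (at x) 1 = \<phi>' x"
proof -
  have fd: "frechet_derivative \<phi> (at x) = (\<lambda>v. \<phi>' x * v)" for x
    using frechet_derivative_at[OF D[THEN has_field_derivative_imp_has_derivative]] by simp
  show "frechet_derivative \<phi> (at x) 1 = \<phi>' x" by (simp add: fd)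
  have "{x. \<phi> x \<noteq> 0} \<subseteq> {a..b}" using supp by blast
  then have "bounded {x. \<phi> x \<noteq> 0}" by (rule bounded_subset[OF bounded_closed_interval])
  then show "test_fun UNIV \<phi>"
    unfolding test_fun_def
  proof (intro conjI allI ballI)
    show "\<phi> differentiable at x" for x
      using D[THEN has_field_derivative_imp_has_derivative] by (rule differentiableI)
    show "continuous_on UNIV (\<lambda>x. frechet_derivative \<phi> (at x) b)" for b
      unfolding fd by (intro continuous_on_mult_right cont)
  qed (simp_all add: compact_closure)
qed

lemma weak_gradient_real:
  assumes "has_weak_gradient h g (UNIV :: real set)" "test_fun UNIV \<phi>"
  shows "(\<integral>x. h x * frechet_derivative \<phi> (at x) 1 \<partial>lborel) = - (\<integral>x. g x * \<phi> x \<partial>lborel)"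
  using assms unfolding has_weak_gradient_def by (simp add: set_lebesgue_integral_def)

text \<open>A C^1 transition from \<open>0\<close> on \<open>{..0}\<close> to \<open>1\<close> on \<open>{1..}\<close>. Its derivative is the hat function on \<open>[0, 1]\<close> with
  integral one, written with positive parts.\<close>

definition smoothstep :: "real \<Rightarrow> real" where
  "smoothstep t = 2 * (max 0 t)\<^sup>2 - 4 * (max 0 (t - 1/2))\<^sup>2 + 2 * (max 0 (t - 1))\<^sup>2"

definition smoothstep' :: "real \<Rightarrow> real" where
  "smoothstep' t = 4 * max 0 t - 8 * max 0 (t - 1/2) + 4 * max 0 (t - 1)"

lemma DERIV_smoothstep: "(smoothstep has_real_derivative smoothstep' t) (at t)"
proof -
  have "((\<lambda>t. (max 0 (t - r))\<^sup>2) has_real_derivative 2 * max 0 (t - r)) (at t)" for r :: real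
  proof -
    have "((\<lambda>t. t - r) has_real_derivative 1) (at t)" by (auto intro!: derivative_eq_intros)
    from DERIV_chain2[OF DERIV_pos_part_square this] show ?thesis by simp
  qed
  note q = this
  show ?thesis
    using DERIV_add[OF DERIV_diff[OF DERIV_cmult[OF q[of 0], of 2] DERIV_cmult[OF q[of "1/2"], of 4]]
        DERIV_cmult[OF q[of 1], of 2]]
    unfolding smoothstep_def[abs_def] smoothstep'_def by simp
qed

lemma continuous_smoothstep':
  "continuous_on UNIV smoothstep'"
  unfolding smoothstep'_def[abs_def] by (intro continuous_intros)

lemma smoothstep_eq:
  "t \<le> 0 \<Longrightarrow> smoothstep t = 0" "t \<ge> 1 \<Longrightarrow> smoothstep t = 1" 
  "t \<notin> {0..1} \<Longrightarrow> smoothstep' t = 0"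
  by (auto simp: smoothstep_def smoothstep'_def max_def power2_eq_square field_simps)

lemma smoothstep_bounds: "0 \<le> smoothstep t" "smoothstep t \<le> 1"
proof -
  consider "t \<le> 0" | "t \<ge> 1" | "0 < t" "t \<le> 1/2" | "1/2 < t" "t < 1" by linarith
  then have "0 \<le> smoothstep t \<and> smoothstep t \<le> 1"
  proof cases
    case 3
    have "t * t \<le> (1/2) * (1/2)" using 3 by (intro mult_mono) auto
    moreover have "max 0 (t - 1/2) = 0" "max 0 (t - 1) = 0" "max 0 t = t" using 3 by auto
    ultimately show ?thesis by (simp add: smoothstep_def power2_eq_square)
  next
    case 4
    have e: "smoothstep t = 1 - 2 * ((1 - t) * (1 - t))"
      using 4 by (simp add: smoothstep_def max_def power2_eq_square field_simps)
    have "(1 - t) * (1 - t) \<le> (1/2) * (1/2)" using 4 by (intro mult_mono) auto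
    moreover have "0 \<le> (1 - t) * (1 - t)" by simp
    ultimately show ?thesis unfolding e by linarith
  qed (auto simp: smoothstep_eq)
  then show "0 \<le> smoothstep t" "smoothstep t \<le> 1" by auto
qed

lemma smoothstep'_integral: "integrable lborel smoothstep'" "(\<integral>t. smoothstep' t \<partial>lborel) = 1"
proof -
  show "integrable lborel smoothstep'"
    by (rule integrable_continuous_compact_support[of "{0..1}"]) (auto simp: continuous_smoothstep' smoothstep_eq)
  have "(\<integral>t. indicator {0..1} t *\<^sub>R smoothstep' t \<partial>lborel) = smoothstep 1 - smoothstep 0"
    by (rule integral_FTC_atLeastAtMost)
       (auto intro: continuous_on_subset[OF continuous_smoothstep'] DERIV_smoothstep has_field_derivative_at_within
         simp: has_real_derivative_iff_has_vector_derivative[symmetric])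
  moreover have "indicator {0..1} t *\<^sub>R smoothstep' t = smoothstep' t" for t
    using smoothstep_eq(3)[of t] by (auto simp: indicator_def)
  ultimately show "(\<integral>t. smoothstep' t \<partial>lborel) = 1"
    by (simp only: smoothstep_eq(1)[OF order_refl] smoothstep_eq(2)[OF order_refl] diff_zero)
qed

text \<open>The substitution \<open>x = a + t / Suc n\<close> reduces this to dominated convergence for the fixed weight \<open>smoothstep'\<close>.\<close>

lemma smoothstep'_approx_identity:
  assumes F: "continuous_on UNIV F"
  shows "(\<lambda>n. \<integral>x. F x * (real (Suc n) * smoothstep' (real (Suc n) * (x - a))) \<partial>lborel) \<longlonglongrightarrow> F a"
proof -
  have eq: "(\<integral>x. F x * (real (Suc n) * smoothstep' (real (Suc n) * (x - a))) \<partial>lborel)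
      = (\<integral>t. F (a + (1 / real (Suc n)) * t) * smoothstep' t \<partial>lborel)" for n
    by (subst lborel_integral_real_affine[of "1 / real (Suc n)" _ a])
       (simp_all add: integral_mult_right_zero[symmetric] del: of_nat_Suc integral_mult_right_zero integral_mult_right)
  have Fm[measurable]: "F \<in> borel_measurable borel" by (rule borel_measurable_continuous_onI[OF F])
  have [measurable]: "smoothstep' \<in> borel_measurable borel"
    by (rule borel_measurable_continuous_onI[OF continuous_smoothstep'])
  have "bounded (F ` {a..a + 1})"
    by (intro compact_imp_bounded compact_continuous_image continuous_on_subset[OF F]) auto
  then obtain B where B: "\<And>x. x \<in> {a..a + 1} \<Longrightarrow> \<bar>F x\<bar> \<le> B" unfolding bounded_iff ball_simps real_norm_def by blast
  have "(\<lambda>n. \<integral>t. F (a + (1 / real (Suc n)) * t) * smoothstep' t \<partial>lborel) \<longlonglongrightarrow> (\<integral>t. F a * smoothstep' t \<partial>lborel)"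
  proof (rule integral_dominated_convergence)
    show "integrable lborel (\<lambda>t. B * \<bar>smoothstep' t\<bar>)" using smoothstep'_integral(1) by simp
    show "AE t in lborel. (\<lambda>n. F (a + 1 / real (Suc n) * t) * smoothstep' t) \<longlonglongrightarrow> F a * smoothstep' t"
    proof (rule AE_I2, rule tendsto_mult[OF _ tendsto_const])
      fix t :: real
      have "(\<lambda>n. a + 1 / real (Suc n) * t) \<longlonglongrightarrow> a + 0 * t"
        by (intro tendsto_intros LIMSEQ_Suc[OF lim_1_over_n])
      then have "(\<lambda>n. a + 1 / real (Suc n) * t) \<longlonglongrightarrow> a" by simp
      moreover have "isCont F a" using F by (simp add: continuous_on_eq_continuous_at)
      ultimately show "(\<lambda>n. F (a + 1 / real (Suc n) * t)) \<longlonglongrightarrow> F a"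
        by (rule isCont_tendsto_compose[rotated])
    qed
    show "AE t in lborel. norm (F (a + 1 / real (Suc n) * t) * smoothstep' t) \<le> B * \<bar>smoothstep' t\<bar>" for n
    proof (rule AE_I2)
      fix t :: real
      show "norm (F (a + 1 / real (Suc n) * t) * smoothstep' t) \<le> B * \<bar>smoothstep' t\<bar>"
      proof (cases "t \<in> {0..1}")
        case True
        then have "1 / real (Suc n) * t \<in> {0..1}" by (auto simp: field_simps)
        then have "a + 1 / real (Suc n) * t \<in> {a..a + 1}" by auto
        from B[OF this] show ?thesis by (simp add: abs_mult mult_right_mono del: of_nat_Suc)
      next
        case False
        then show ?thesis by (simp add: smoothstep_eq)
      qed
    qed
  qed measurable
  then show ?thesis by (simp add: eq smoothstep'_integral(2) del: of_nat_Suc)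
qed

text \<open>An approximation of the indicator function of \<open>{a<..b}\<close>. Both transitions lie to the right of the endpoints, which is why
  the limit includes \<open>b\<close> but not \<open>a\<close>.\<close>

definition cutoff :: "real \<Rightarrow> real \<Rightarrow> nat \<Rightarrow> real \<Rightarrow> real" where
  "cutoff a b n x = smoothstep (real (Suc n) * (x - a)) - smoothstep (real (Suc n) * (x - b))"

lemma smoothstep_tendsto:
  "(\<lambda>n. smoothstep (real (Suc n) * (x - a))) \<longlonglongrightarrow> indicator {a<..} x"
proof (cases "x > a")
  case True
  obtain N where N: "real N > 1 / (x - a)" using reals_Archimedean2 by blast
  have "smoothstep (real (Suc n) * (x - a)) = 1" if "n \<ge> N" for n
  proof (rule smoothstep_eq)
    have "1 / (x - a) \<le> real (Suc n)" using N that by simp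
    then show "1 \<le> real (Suc n) * (x - a)" using True by (simp add: field_simps)
  qed
  then have "\<forall>\<^sub>F n in sequentially. smoothstep (real (Suc n) * (x - a)) = indicator {a<..} x"
    using True unfolding eventually_sequentially by auto
  then show ?thesis by (rule tendsto_eventually)
next
  case False
  then have "smoothstep (real (Suc n) * (x - a)) = indicator {a<..} x" for n
    by (subst smoothstep_eq(1)) (auto simp: mult_nonneg_nonpos)
  then show ?thesis by simp
qed

lemma cutoff_outside:
  assumes "a \<le> b" "x \<notin> {a..b + 1}" shows "cutoff a b n x = 0"
proof (cases "x < a")
  case True
  then have "real (Suc n) * (x - a) \<le> 0" "real (Suc n) * (x - b) \<le> 0"
    using assms(1) by (simp_all only: mult_le_0_iff) auto
  then show ?thesis by (simp add: cutoff_def smoothstep_eq)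
next
  case False
  then have x: "x - b \<ge> 1" using assms(2) by auto
  have "1 * 1 \<le> real (Suc n) * (x - b)" using x by (intro mult_mono) auto
  moreover have "1 * 1 \<le> real (Suc n) * (x - a)" using x assms(1) by (intro mult_mono) auto
  ultimately show ?thesis by (simp add: cutoff_def smoothstep_eq del: of_nat_Suc)
qed

lemma cutoff_integral_tendsto:
  assumes f: "set_integrable lborel {a..b + 1} f" and ab: "a \<le> b"
  shows "(\<lambda>n. \<integral>x. f x * cutoff a b n x \<partial>lborel) \<longlonglongrightarrow> (LINT x:{a<..b}|lborel. f x)"
proof -
  let ?f = "\<lambda>x. indicator {a..b + 1} x *\<^sub>R f x"
  have int: "integrable lborel ?f" using f by (simp add: set_integrable_def)
  note [measurable] = borel_measurable_integrable[OF int]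
  have [measurable]: "smoothstep \<in> borel_measurable borel"
    by (intro borel_measurable_continuous_onI continuous_at_imp_continuous_on ballI DERIV_isCont[OF DERIV_smoothstep])
  have [measurable]: "cutoff a b n \<in> borel_measurable borel" for n
    unfolding cutoff_def[abs_def] by measurable
  have "(\<lambda>n. \<integral>x. ?f x * cutoff a b n x \<partial>lborel) \<longlonglongrightarrow> (\<integral>x. ?f x * indicator {a<..b} x \<partial>lborel)"
  proof (rule integral_dominated_convergence)
    show "integrable lborel (\<lambda>x. \<bar>?f x\<bar>)" using int by (rule integrable_abs)
    show "AE x in lborel. (\<lambda>n. ?f x * cutoff a b n x) \<longlonglongrightarrow> ?f x * indicator {a<..b} x"
    proof (rule AE_I2, rule tendsto_mult[OF tendsto_const])
      fix x
      have "(\<lambda>n. cutoff a b n x) \<longlonglongrightarrow> indicator {a<..} x - indicator {b<..} x"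
        unfolding cutoff_def by (intro tendsto_diff smoothstep_tendsto)
      also have "indicator {a<..} x - indicator {b<..} x = (indicator {a<..b} x :: real)"
        using ab by (auto simp: indicator_def)
      finally show "(\<lambda>n. cutoff a b n x) \<longlonglongrightarrow> indicator {a<..b} x" .
    qed
    show "AE x in lborel. norm (?f x * cutoff a b n x) \<le> \<bar>?f x\<bar>" for n
    proof (rule AE_I2)
      fix x
      have "\<bar>cutoff a b n x\<bar> \<le> 1"
        unfolding cutoff_def
        using smoothstep_bounds[of "real (Suc n) * (x - a)"] smoothstep_bounds[of "real (Suc n) * (x - b)"]
        by linarith
      then show "norm (?f x * cutoff a b n x) \<le> \<bar>?f x\<bar>"
        using mult_left_mono[of "\<bar>cutoff a b n x\<bar>" 1 "\<bar>?f x\<bar>"] by (simp only: real_norm_def abs_mult) simp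
    qed
  qed measurable
  moreover have "?f x * cutoff a b n x = f x * cutoff a b n x" for x n
    using cutoff_outside[OF ab, of x n] by (cases "x \<in> {a..b + 1}") auto
  moreover have "?f x * indicator {a<..b} x = indicator {a<..b} x *\<^sub>R f x" for x
    by (auto simp: indicator_def)
  ultimately show ?thesis unfolding set_lebesgue_integral_def by (simp only:)
qed

text \<open>Test the weak derivative with \<open>p * cutoff a b n\<close>. The two transitions of the cutoff function act as
  approximate point evaluations of \<open>h * p\<close> at the endpoints, where continuity of \<open>h\<close> enters.\<close>

lemma weak_gradient_by_parts:
  fixes h g p p' :: "real \<Rightarrow> real"
  assumes h: "continuous_on UNIV h" and hg: "has_weak_gradient h g UNIV"
    and p: "\<And>x. (p has_real_derivative p' x) (at x)" and p': "continuous_on UNIV p'" and ab: "a \<le> b"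
  shows "(LINT x:{a<..b}|lborel. h x * p' x) = h b * p b - h a * p a - (LINT x:{a<..b}|lborel. g x * p x)"
proof -
  let ?\<phi> = "\<lambda>n x. p x * cutoff a b n x"
  let ?s = "\<lambda>n c x. real (Suc n) * smoothstep' (real (Suc n) * (x - c))"
  let ?\<phi>' = "\<lambda>n x. p' x * cutoff a b n x + p x * (?s n a x - ?s n b x)"
  have pc: "continuous_on UNIV p" by (intro continuous_at_imp_continuous_on ballI DERIV_isCont[OF p])
  have Dcut: "(cutoff a b n has_real_derivative (?s n a x - ?s n b x)) (at x)" for n x
  proof -
    have "((\<lambda>x. smoothstep (real (Suc n) * (x - c))) has_real_derivative smoothstep' (real (Suc n) * (x - c)) * real (Suc n)) (at x)" for c
      by (rule DERIV_chain2[OF DERIV_smoothstep]) (auto intro!: derivative_eq_intros)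
    from DERIV_diff[OF this[of a] this[of b]] show ?thesis
      unfolding cutoff_def[abs_def] by (rule DERIV_cong) (simp only: mult.commute)
  qed
  have ccut: "continuous_on UNIV (cutoff a b n)" for n
    by (intro continuous_at_imp_continuous_on ballI DERIV_isCont[OF Dcut])
  have cs: "continuous_on UNIV (?s n c)" for n c
    by (intro continuous_intros continuous_on_compose2[OF continuous_smoothstep']) auto
  have D: "(?\<phi> n has_real_derivative ?\<phi>' n x) (at x)" for n x
    by (rule DERIV_cong[OF DERIV_mult[OF p Dcut]]) (simp only: mult.commute)
  have C: "continuous_on UNIV (?\<phi>' n)" for n
    by (intro continuous_on_add continuous_on_mult continuous_on_diff p' pc ccut cs)
  have supp: "?\<phi> n x = 0" if "x \<notin> {a..b + 1}" for n x using cutoff_outside[OF ab that] by simp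
  note tf = test_fun_real[OF D C supp]
  have eq: "(\<integral>x. h x * ?\<phi>' n x \<partial>lborel) = - (\<integral>x. g x * ?\<phi> n x \<partial>lborel)" for n
    using weak_gradient_real[OF hg tf(1)] by (simp only: tf(2))
  have supps: "?s n c x = 0" if "x \<notin> {c..c+1}" for n c x
  proof -
    have "real (Suc n) * (x - c) \<notin> {0..1}"
    proof (cases "x < c")
      case True
      then have "real (Suc n) * (x - c) < 0" by (simp add: mult_pos_neg del: of_nat_Suc)
      then show ?thesis by simp
    next
      case False
      then have x: "x - c > 1" using that by auto
      have "x - c \<le> real (Suc n) * (x - c)" using x mult_right_mono[of 1 "real (Suc n)" "x - c"] by simp
      then have "1 < real (Suc n) * (x - c)" using x by (rule less_le_trans[rotated])
      then show ?thesis unfolding atLeastAtMost_iff by (blast dest: leD)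
    qed
    then show ?thesis by (simp add: smoothstep_eq(3) del: of_nat_Suc)
  qed
  have i1: "integrable lborel (\<lambda>x. h x * p' x * cutoff a b n x)" for n
    by (rule integrable_continuous_compact_support[of "{a..b + 1}"])
       (simp_all add: cutoff_outside[OF ab] continuous_on_mult h p' ccut)
  have i2: "integrable lborel (\<lambda>x. h x * p x * ?s n c x)" for n c
  proof (rule integrable_continuous_compact_support[of "{c..c + 1}"])
    show "continuous_on UNIV (\<lambda>x. h x * p x * ?s n c x)" by (intro continuous_on_mult[OF _ cs] continuous_on_mult h pc)
    show "h x * p x * ?s n c x = 0" if "x \<notin> {c..c + 1}" for x using supps[OF that] by simp
  qed simp
  have split: "(\<integral>x. h x * ?\<phi>' n x \<partial>lborel) = (\<integral>x. h x * p' x * cutoff a b n x \<partial>lborel)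
      + ((\<integral>x. h x * p x * ?s n a x \<partial>lborel) - (\<integral>x. h x * p x * ?s n b x \<partial>lborel))" for n
  proof -
    have e: "h x * ?\<phi>' n x = h x * p' x * cutoff a b n x + (h x * p x * ?s n a x - h x * p x * ?s n b x)" for x
      by (simp only: distrib_left right_diff_distrib mult.assoc)
    show ?thesis unfolding e
      by (subst Bochner_Integration.integral_add[OF i1 Bochner_Integration.integrable_diff[OF i2 i2]])
         (simp only: Bochner_Integration.integral_diff[OF i2 i2])
  qed
  have "(\<lambda>n. \<integral>x. h x * ?\<phi>' n x \<partial>lborel) \<longlonglongrightarrow> (LINT x:{a<..b}|lborel. h x * p' x) + (h a * p a - h b * p b)"
    unfolding split
  proof (intro tendsto_add tendsto_diff cutoff_integral_tendsto ab)
    show "set_integrable lborel {a..b + 1} (\<lambda>x. h x * p' x)"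
      by (intro borel_integrable_atLeastAtMost' continuous_on_mult continuous_on_subset[OF h] continuous_on_subset[OF p']) auto
  qed (intro smoothstep'_approx_identity continuous_on_mult h pc)+
  moreover have "(\<lambda>n. - (\<integral>x. g x * p x * cutoff a b n x \<partial>lborel)) \<longlonglongrightarrow> - (LINT x:{a<..b}|lborel. g x * p x)"
  proof (intro tendsto_minus cutoff_integral_tendsto ab)
    have "set_integrable lborel {a..b + 1} g"
      using hg by (auto simp: has_weak_gradient_def loc_integrable_def)
    then show "set_integrable lborel {a..b + 1} (\<lambda>x. g x * p x)"
      by (rule set_integrable_mult_continuous[OF _ compact_Icc]) (auto intro: continuous_on_subset[OF pc])
  qed
  ultimately have "(LINT x:{a<..b}|lborel. h x * p' x) + (h a * p a - h b * p b) = - (LINT x:{a<..b}|lborel. g x * p x)"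
    unfolding eq mult.assoc[symmetric] by (rule LIMSEQ_unique)
  then show ?thesis by linarith
qed

text \<open>The positive and negative parts of \<open>F\<close> are densities of finite measures that agree on all half-lines, hence of the same
  measure, and densities are unique almost everywhere.\<close>

lemma AE_zero_if_integrals_zero:
  fixes F :: "real \<Rightarrow> real"
  assumes F: "integrable lborel F" and zero: "\<And>x. (LINT t:{x<..}|lborel. F t) = 0"
  shows "AE t in lborel. F t = 0"
proof -
  note [measurable] = borel_measurable_integrable[OF F]
  let ?p = "\<lambda>t. max 0 (F t)" and ?n = "\<lambda>t. max 0 (- F t)"
  have int: "integrable lborel ?p" "integrable lborel ?n"
    using F by (auto intro: integrable_max)
  have em: "emeasure (density lborel (\<lambda>t. ennreal (f t))) {x<..} = ennreal (LINT t:{x<..}|lborel. f t)"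
    if "integrable lborel f" "\<And>t. 0 \<le> f t" for f :: "real \<Rightarrow> real" and x
  proof -
    note [measurable] = borel_measurable_integrable[OF that(1)]
    have "emeasure (density lborel (\<lambda>t. ennreal (f t))) {x<..} = (\<integral>\<^sup>+t. ennreal (indicator {x<..} t * f t) \<partial>lborel)"
      by (subst emeasure_density) (auto intro!: nn_integral_cong simp: indicator_def)
    also have "\<dots> = ennreal (\<integral>t. indicator {x<..} t * f t \<partial>lborel)"
      using that integrable_mult_indicator[of "{x<..}" lborel f] by (intro nn_integral_eq_integral) auto
    finally show ?thesis by (simp add: set_lebesgue_integral_def)
  qed
  have eq: "density lborel (\<lambda>t. ennreal (?p t)) = density lborel (\<lambda>t. ennreal (?n t))"
  proof (rule measure_eqI_lessThan)
    fix x :: real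
    show "emeasure (density lborel (\<lambda>t. ennreal (?p t))) {x<..} < \<infinity>" by (simp add: em[OF int(1)])
    have "set_integrable lborel {x<..} ?p" "set_integrable lborel {x<..} ?n"
      unfolding set_integrable_def by (intro integrable_mult_indicator int; simp)+
    from set_integral_diff(2)[OF this]
    have "(LINT t:{x<..}|lborel. ?p t) - (LINT t:{x<..}|lborel. ?n t) = (LINT t:{x<..}|lborel. ?p t - ?n t)" ..
    also have "(\<lambda>t. ?p t - ?n t) = F" by (auto simp: max_def)
    finally have "(LINT t:{x<..}|lborel. ?p t) = (LINT t:{x<..}|lborel. ?n t)" using zero[of x] by simp
    then show "emeasure (density lborel (\<lambda>t. ennreal (?p t))) {x<..} = emeasure (density lborel (\<lambda>t. ennreal (?n t))) {x<..}"
      by (simp add: em[OF int(1)] em[OF int(2)])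
  qed simp_all
  have "AE t in lborel. ennreal (?p t) = ennreal (?n t)"
    by (rule sigma_finite_measure.density_unique[OF sigma_finite_lborel _ _ eq]) measurable
  then show ?thesis by eventually_elim (auto simp: max_def split: if_splits)
qed

lemma weak_gradient_FTC:
  fixes h g :: "real \<Rightarrow> real"
  assumes "continuous_on UNIV h" "has_weak_gradient h g UNIV" "a \<le> b"
  shows "(LINT x:{a<..b}|lborel. g x) = h b - h a"
  using weak_gradient_by_parts[OF assms(1,2) _ _ assms(3), of "\<lambda>_. 1" "\<lambda>_. 0"] by (simp add: set_lebesgue_integral_def)

text \<open>Both derivatives have the increments of \<open>h\<close> as integrals over intervals. Cutting off to bounded windows makes the
  difference integrable on the whole line.\<close>

lemma weak_gradient_unique:
  fixes h g1 g2 :: "real \<Rightarrow> real"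
  assumes h: "continuous_on UNIV h" and g1: "has_weak_gradient h g1 UNIV" and g2: "has_weak_gradient h g2 UNIV"
  shows "AE x in lborel. g1 x = g2 x"
proof -
  have si: "set_integrable lborel {a<..b} g1" "set_integrable lborel {a<..b} g2" for a b
  proof -
    have "set_integrable lborel {a..b} g1" "set_integrable lborel {a..b} g2"
      using g1 g2 unfolding has_weak_gradient_def loc_integrable_def by auto
    then show "set_integrable lborel {a<..b} g1" "set_integrable lborel {a<..b} g2"
      by (auto elim!: set_integrable_subset)
  qed
  have "AE x in lborel. indicator {-real N<..real N} x *\<^sub>R (g1 x - g2 x) = 0" for N :: nat
  proof (rule AE_zero_if_integrals_zero)
    show "integrable lborel (\<lambda>x. indicator {-real N<..real N} x *\<^sub>R (g1 x - g2 x))"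
      using set_integral_diff(1)[OF si] by (simp add: set_integrable_def)
    fix y :: real
    show "(LINT x:{y<..}|lborel. indicator {-real N<..real N} x *\<^sub>R (g1 x - g2 x)) = 0"
    proof -
      have "(LINT x:{y<..}|lborel. indicator {-real N<..real N} x *\<^sub>R (g1 x - g2 x))
          = (LINT x:{max y (-real N)<..real N}|lborel. g1 x - g2 x)"
        unfolding set_lebesgue_integral_def
        by (rule arg_cong[where f="integral\<^sup>L lborel"], rule ext) (auto simp: indicator_def)
      also have "\<dots> = 0"
      proof (cases "max y (-real N) \<le> real N")
        case True
        show ?thesis
          using set_integral_diff(2)[OF si, of "max y (-real N)" "real N"]
            weak_gradient_FTC[OF h g1 True] weak_gradient_FTC[OF h g2 True] by simp
      next
        case False
        then have "{max y (-real N)<..real N} = {}" by auto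
        then show ?thesis by (simp only: set_lebesgue_integral_def) simp
      qed
      finally show ?thesis .
    qed
  qed
  then have "AE x in lborel. \<forall>N::nat. indicator {-real N<..real N} x *\<^sub>R (g1 x - g2 x) = 0"
    unfolding AE_all_countable by blast
  then show ?thesis
  proof eventually_elim
    case (elim x)
    obtain N :: nat where "real N > \<bar>x\<bar>" using reals_Archimedean2 by blast
    then have "x \<in> {-real N<..real N}" by auto
    with elim[rule_format, of N] show ?case by simp
  qed
qed

lemma weak_gradient_measurable:
  fixes h g :: "real \<Rightarrow> real"
  assumes "has_weak_gradient h g UNIV"
  shows "g \<in> borel_measurable borel"
  using loc_integrable_measurable[of UNIV g] assms by (simp add: has_weak_gradient_def)

section \<open>The energy of a single interval\<close>

lemma integral_centered_square:
  fixes a b :: real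
  assumes "a \<le> b"
  shows "set_integrable lborel {a<..b} (\<lambda>x. (x - (a + b) / 2)\<^sup>2)"
    and "(LINT x:{a<..b}|lborel. (x - (a + b) / 2)\<^sup>2) = (b - a) ^ 3 / 12"
proof -
  have i: "set_integrable lborel {a..b} (\<lambda>x. (x - (a + b) / 2)\<^sup>2)"
    by (intro borel_integrable_atLeastAtMost' continuous_intros)
  then show "set_integrable lborel {a<..b} (\<lambda>x. (x - (a + b) / 2)\<^sup>2)"
    by (rule set_integrable_subset) auto
  have "(LINT x:{a..b}|lborel. (x - (a + b) / 2)\<^sup>2) = (b - (a + b) / 2) ^ 3 / 3 - (a - (a + b) / 2) ^ 3 / 3"
    unfolding set_lebesgue_integral_def
  proof (rule integral_FTC_atLeastAtMost[OF assms])
    fix x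
    have "((\<lambda>x. (x - (a + b) / 2) ^ 3 / 3) has_real_derivative (x - (a + b) / 2)\<^sup>2) (at x)"
      by (auto intro!: derivative_eq_intros)
    then show "((\<lambda>x. (x - (a + b) / 2) ^ 3 / 3) has_vector_derivative (x - (a + b) / 2)\<^sup>2) (at x within {a..b})"
      unfolding has_real_derivative_iff_has_vector_derivative[symmetric]
      by (rule has_field_derivative_at_within)
  qed (intro continuous_intros)
  also have "\<dots> = (b - a) ^ 3 / 12" by (simp add: power3_eq_cube field_simps)
  also have "(LINT x:{a..b}|lborel. (x - (a + b) / 2)\<^sup>2) = (LINT x:{a<..b}|lborel. (x - (a + b) / 2)\<^sup>2)"
    unfolding set_lebesgue_integral_def
  proof (rule integral_cong_AE)
    show "AE x in lborel. indicat_real {a..b} x *\<^sub>R (x - (a + b) / 2)\<^sup>2 = indicat_real {a<..b} x *\<^sub>R (x - (a + b) / 2)\<^sup>2"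
      using AE_lborel_singleton[of a] by eventually_elim (auto simp: indicator_def)
  qed measurable
  finally show "(LINT x:{a<..b}|lborel. (x - (a + b) / 2)\<^sup>2) = (b - a) ^ 3 / 12" .
qed

text \<open>Integration by parts against \<open>x - (a + b) / 2\<close> expresses the mass \<open>m\<close> through \<open>g\<close>, so the coefficient \<open>12 * m / (b - a) ^ 3\<close>
  is the one that makes the square complete. The statement keeps the remainder because its vanishing identifies
  the parabola.\<close>

lemma interval_deriv_energy:
  fixes h g :: "real \<Rightarrow> real"
  assumes h: "continuous_on UNIV h" and hg: "has_weak_gradient h g UNIV"
    and ab: "a < b" and bd: "h a = 0" "h b = 0"
  defines "m \<equiv> (LINT x:{a<..b}|lborel. h x)"
  assumes sq: "set_integrable lborel {a<..b} (\<lambda>x. (g x)\<^sup>2)"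
  shows "(LINT x:{a<..b}|lborel. (g x)\<^sup>2)
     = 12 * m\<^sup>2 / (b - a) ^ 3 + (LINT x:{a<..b}|lborel. (g x + 12 * m / (b - a) ^ 3 * (x - (a + b) / 2))\<^sup>2)"
    and "set_integrable lborel {a<..b} (\<lambda>x. (g x + 12 * m / (b - a) ^ 3 * (x - (a + b) / 2))\<^sup>2)"
proof -
  let ?c = "(a + b) / 2" and ?L = "b - a"
  define k where "k = 12 * m / ?L ^ 3"
  have "set_integrable lborel {a..b} g" using hg by (auto simp: has_weak_gradient_def loc_integrable_def)
  then have "set_integrable lborel {a..b} (\<lambda>x. g x * (x - ?c))"
    by (rule set_integrable_mult_continuous) (auto intro!: continuous_intros)
  then have i1: "set_integrable lborel {a<..b} (\<lambda>x. g x * (x - ?c))"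
    by (rule set_integrable_subset) auto
  note i2 = integral_centered_square(1)[OF less_imp_le[OF ab]]
  have "(LINT x:{a<..b}|lborel. h x * 1) = h b * (b - ?c) - h a * (a - ?c) - (LINT x:{a<..b}|lborel. g x * (x - ?c))"
    by (rule weak_gradient_by_parts[OF h hg]) (use ab in \<open>auto intro!: derivative_eq_intros\<close>)
  then have m: "(LINT x:{a<..b}|lborel. g x * (x - ?c)) = - m" by (simp add: bd m_def)
  have e: "(g x + k * (x - ?c))\<^sup>2 = (g x)\<^sup>2 + ((2 * k) * (g x * (x - ?c)) + k\<^sup>2 * (x - ?c)\<^sup>2)" for x
    by (simp add: power2_sum power_mult_distrib)
  have i3: "set_integrable lborel {a<..b} (\<lambda>x. (2 * k) * (g x * (x - ?c)))"
    and i4: "set_integrable lborel {a<..b} (\<lambda>x. k\<^sup>2 * (x - ?c)\<^sup>2)"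
    by (rule set_integrable_mult_right, rule i1, rule set_integrable_mult_right, rule i2)
  note i34 = set_integral_add(1)[OF i3 i4]
  show "set_integrable lborel {a<..b} (\<lambda>x. (g x + 12 * m / ?L ^ 3 * (x - ?c))\<^sup>2)"
    unfolding k_def[symmetric] e by (rule set_integral_add(1)[OF sq i34])
  have "(LINT x:{a<..b}|lborel. (g x + k * (x - ?c))\<^sup>2)
      = (LINT x:{a<..b}|lborel. (g x)\<^sup>2) + (2 * k * (- m) + k\<^sup>2 * (?L ^ 3 / 12))"
    unfolding e set_integral_add(2)[OF sq i34] set_integral_add(2)[OF i3 i4]
    by (simp only: set_integral_mult_right m integral_centered_square(2)[OF less_imp_le[OF ab]])
  moreover have "2 * k * (- m) + k\<^sup>2 * (?L ^ 3 / 12) = - (12 * m\<^sup>2 / ?L ^ 3)"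
  proof -
    have "?L ^ 3 \<noteq> 0" using ab by simp
    then show ?thesis unfolding k_def
      by (simp add: power2_eq_square field_simps)
  qed
  ultimately show "(LINT x:{a<..b}|lborel. (g x)\<^sup>2)
     = 12 * m\<^sup>2 / ?L ^ 3 + (LINT x:{a<..b}|lborel. (g x + 12 * m / ?L ^ 3 * (x - ?c))\<^sup>2)"
    unfolding k_def[symmetric] by linarith
qed

text \<open>This is \<open>interval_energy_bound\<close> below in the dimensionless variable \<open>s = L / (2 * ell)\<close>. With \<open>q = root 5 m\<close> and
  \<open>s = r * q\<^sup>2\<close> all terms scale with the same power of \<open>q\<close>, except for one further factor \<open>q \<le> 1\<close>. What remains is the inequality
  \<open>5 * r ^ 3 \<le> 3 * r ^ 5 + 2\<close>, in which the difference of the two sides has the factor \<open>(r - 1)\<^sup>2\<close>.\<close>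

lemma scalar_ineq:
  fixes s m :: real
  assumes s: "s > 0" and m: "0 \<le> m" "m \<le> 1"
  shows "5 * m \<le> 3 * s\<^sup>2 + 2 * m\<^sup>2 / s ^ 3"
    and "5 * m = 3 * s\<^sup>2 + 2 * m\<^sup>2 / s ^ 3 \<Longrightarrow> m = 1 \<and> s = 1"
proof -
  let ?D = "3 * s ^ 5 + 2 * m\<^sup>2 - 5 * m * s ^ 3"
  have D: "?D \<ge> 0 \<and> (?D = 0 \<longrightarrow> m = 1 \<and> s = 1)"
  proof (cases "m = 0")
    case True
    then show ?thesis using s by (simp add: zero_le_power less_imp_le)
  next
    case False
    define q where "q = root 5 m"
    have q: "0 < q" "q \<le> 1" "q ^ 5 = m"
      using m False by (auto simp: q_def real_root_pow_pos2)
    define r where "r = s / q\<^sup>2"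
    have r: "r > 0" "s = r * q\<^sup>2" using s q by (auto simp: r_def)
    have e1: "?D = q ^ 10 * (3 * r ^ 5 + 2 - 5 * r ^ 3 * q)"
      by (simp add: r(2) q(3)[symmetric] power_mult_distrib power_mult[symmetric] algebra_simps flip: power_add)
        (simp add: eval_nat_numeral)
    have e2: "3 * r ^ 5 + 2 - 5 * r ^ 3 * q = (r - 1)\<^sup>2 * (3 * r ^ 3 + 6 * r\<^sup>2 + 4 * r + 2) + 5 * r ^ 3 * (1 - q)"
      by (simp add: algebra_simps eval_nat_numeral)
    have pos: "3 * r ^ 3 + 6 * r\<^sup>2 + 4 * r + 2 > 0" "5 * r ^ 3 > 0" "q ^ 10 > 0"
      using r(1) q(1) by (simp_all add: add_pos_pos)
    have nn: "0 \<le> (r - 1)\<^sup>2 * (3 * r ^ 3 + 6 * r\<^sup>2 + 4 * r + 2)" "0 \<le> 5 * r ^ 3 * (1 - q)"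
      using pos q by (auto intro!: mult_nonneg_nonneg)
    have "?D \<ge> 0" unfolding e1 e2 using nn pos(3) by (intro mult_nonneg_nonneg) auto
    moreover have "m = 1 \<and> s = 1" if "?D = 0"
    proof -
      have "(r - 1)\<^sup>2 * (3 * r ^ 3 + 6 * r\<^sup>2 + 4 * r + 2) + 5 * r ^ 3 * (1 - q) = 0"
        using that pos(3) unfolding e1 e2 by simp
      then have "(r - 1)\<^sup>2 * (3 * r ^ 3 + 6 * r\<^sup>2 + 4 * r + 2) = 0" "5 * r ^ 3 * (1 - q) = 0"
        using nn by linarith+
      then have "r = 1" "q = 1" using pos by auto
      then show ?thesis using r(2) q(3) by simp
    qed
    ultimately show ?thesis by blast
  qed
  have eq: "3 * s\<^sup>2 + 2 * m\<^sup>2 / s ^ 3 - 5 * m = ?D / s ^ 3"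
    using s by (simp add: field_simps eval_nat_numeral)
  have "?D / s ^ 3 \<ge> 0" using D s by simp
  then show "5 * m \<le> 3 * s\<^sup>2 + 2 * m\<^sup>2 / s ^ 3" using eq by linarith
  assume "5 * m = 3 * s\<^sup>2 + 2 * m\<^sup>2 / s ^ 3"
  then have "?D / s ^ 3 = 0" using eq by linarith
  then show "m = 1 \<and> s = 1" using D s by simp
qed

lemma ell_pos: "ell > 0" using C_W_pos by (simp add: ell_def)

lemma C_W_eq: "C_W = 9 / (16 * ell ^ 5)"
proof -
  have "ell ^ 5 = ell powr 5" using ell_pos by (simp add: powr_numeral)
  also have "\<dots> = (9 / (16 * C_W)) powr 1" unfolding ell_def by (simp add: powr_powr)
  also have "\<dots> = 9 / (16 * C_W)" using C_W_pos by simp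
  finally show ?thesis using C_W_pos ell_pos by (simp add: field_simps)
qed

text \<open>The energy of the parabola: \<open>C_W * (2 * ell)\<^sup>2 = 9 / (4 * ell ^ 3)\<close> from the boundary-value problem and
  \<open>3 / (2 * ell ^ 3)\<close> from the derivative.\<close>

definition min_energy :: real where "min_energy = 15 / (4 * ell ^ 3)"

text \<open>Linear in the mass, so that it can be summed over the components. Equality forces all the mass to sit on a single interval
  of the optimal length.\<close>

lemma interval_energy_bound:
  assumes L: "L > 0" and m: "0 \<le> m" "m \<le> 1"
  shows "min_energy * m \<le> C_W * L\<^sup>2 + 12 * m\<^sup>2 / L ^ 3"
    and "min_energy * m = C_W * L\<^sup>2 + 12 * m\<^sup>2 / L ^ 3 \<Longrightarrow> m = 1 \<and> L = 2 * ell"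
proof -
  define s where "s = L / (2 * ell)"
  have s: "s > 0" "L = 2 * ell * s" using L ell_pos by (auto simp: s_def)
  have k: "3 / (4 * ell ^ 3) > 0" using ell_pos by simp
  have e: "C_W * L\<^sup>2 + 12 * m\<^sup>2 / L ^ 3 = 3 / (4 * ell ^ 3) * (3 * s\<^sup>2 + 2 * m\<^sup>2 / s ^ 3)"
    unfolding C_W_eq s(2) using ell_pos s(1) by (simp add: field_simps eval_nat_numeral)
  have e': "min_energy * m = 3 / (4 * ell ^ 3) * (5 * m)"
    by (simp add: min_energy_def)
  show "min_energy * m \<le> C_W * L\<^sup>2 + 12 * m\<^sup>2 / L ^ 3"
    unfolding e e' using scalar_ineq(1)[OF s(1) m] k by (intro mult_left_mono) auto
  assume "min_energy * m = C_W * L\<^sup>2 + 12 * m\<^sup>2 / L ^ 3"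
  then have "5 * m = 3 * s\<^sup>2 + 2 * m\<^sup>2 / s ^ 3" unfolding e e' using k by (metis less_irrefl mult_left_cancel)
  from scalar_ineq(2)[OF s(1) m this] show "m = 1 \<and> L = 2 * ell" using s(2) by simp
qed

text \<open>The endpoints cannot belong to \<open>\<Omega>\<close>, since a small ball around them could be added to the component. This is what makes
  \<open>h\<close> vanish at the ends of the components of \<open>{h > 0}\<close>.\<close>

lemma bounded_component_interval:
  fixes \<Omega> C :: "real set"
  assumes \<Omega>: "open \<Omega>" and C: "C \<in> components \<Omega>" and bd: "bounded C"
  obtains a b where "a < b" "C = {a<..<b}" "a \<notin> \<Omega>" "b \<notin> \<Omega>"
proof -
  have opC: "open C" using open_components \<Omega> C by blast
  have ne: "C \<noteq> {}" using in_components_nonempty C by blast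
  have int: "is_interval C" using in_components_connected[OF C] by (simp add: is_interval_connected_1)
  have bb: "bdd_below C" "bdd_above C" using bd by (simp_all add: bounded_imp_bdd_below bounded_imp_bdd_above)
  let ?a = "Inf C" and ?b = "Sup C"
  have in_ab: "?a < x \<and> x < ?b" if x: "x \<in> C" for x
  proof -
    obtain e where e: "e > 0" "ball x e \<subseteq> C" using opC x by (auto elim: openE)
    have "x - e/2 \<in> ball x e" "x + e/2 \<in> ball x e" using e(1) by (auto simp: dist_real_def)
    then have "x - e/2 \<in> C" "x + e/2 \<in> C" using e(2) by auto
    then have "?a \<le> x - e/2" "x + e/2 \<le> ?b" using bb by (auto intro: cInf_lower cSup_upper)
    then show ?thesis using e(1) by linarith
  qed
  have C_eq: "C = {?a<..<?b}"
  proof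
    show "C \<subseteq> {?a<..<?b}" using in_ab by auto
    show "{?a<..<?b} \<subseteq> C"
    proof
      fix z assume "z \<in> {?a<..<?b}"
      then have z: "Inf C < z" "z < Sup C" by auto
      obtain x where x: "x \<in> C" "x < z" using z(1) cInf_less_iff[OF ne bb(1)] by blast
      obtain y where y: "y \<in> C" "z < y" using z(2) less_cSup_iff[OF ne bb(2)] by blast
      show "z \<in> C" using mem_is_interval_1_I[OF int x(1) y(1)] x y by simp
    qed
  qed
  have absorb: "p \<in> C" if p: "p \<in> \<Omega>" and near: "\<And>e. e > 0 \<Longrightarrow> \<exists>x\<in>C. \<bar>x - p\<bar> < e" for p
  proof -
    obtain e where e: "e > 0" "ball p e \<subseteq> \<Omega>" using \<Omega> p by (auto elim: openE)
    obtain x where x: "x \<in> C" "\<bar>x - p\<bar> < e" using near e(1) by blast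
    have "C \<inter> ball p e \<noteq> {}" using x by (auto simp: dist_real_def abs_minus_commute)
    then have "ball p e \<subseteq> C" using components_maximal[OF C connected_ball e(2)] by blast
    then show ?thesis using e(1) by (meson centre_in_ball subsetD)
  qed
  show thesis
  proof (rule that[OF _ C_eq])
    show "?a < ?b" using ne in_ab by fastforce
    show "?a \<notin> \<Omega>"
    proof
      assume "?a \<in> \<Omega>"
      then have "?a \<in> C"
      proof (rule absorb)
        fix e :: real assume "e > 0"
        then have "Inf C < ?a + e" by simp
        then obtain x where "x \<in> C" "x < ?a + e" using cInf_less_iff[OF ne bb(1)] by blast
        moreover have "?a < x" using in_ab \<open>x \<in> C\<close> by blast
        ultimately show "\<exists>x\<in>C. \<bar>x - ?a\<bar> < e" by (intro bexI[of _ x]) auto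
      qed
      then show False using in_ab[of ?a] by simp
    qed
    show "?b \<notin> \<Omega>"
    proof
      assume "?b \<in> \<Omega>"
      then have "?b \<in> C"
      proof (rule absorb)
        fix e :: real assume "e > 0"
        then have "?b - e < Sup C" by simp
        then obtain x where "x \<in> C" "?b - e < x" using less_cSup_iff[OF ne bb(2)] by blast
        moreover have "x < ?b" using in_ab \<open>x \<in> C\<close> by blast
        ultimately show "\<exists>x\<in>C. \<bar>x - ?b\<bar> < e" by (intro bexI[of _ x]) auto
      qed
      then show False using in_ab[of ?b] by simp
    qed
  qed
qed

lemma open_null_imp_empty:
  fixes W :: "real set"
  assumes "open W" "AE x in lborel. x \<notin> W"
  shows "W = {}"
proof -
  have "W \<in> null_sets lborel" using assms by (subst AE_iff_null_sets) auto
  then have "negligible W" by (simp add: negligible_iff_null_sets null_sets_completionI)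
  then show ?thesis using open_not_negligible[OF assms(1)] by blast
qed

section \<open>The parabola and its energy\<close>

text \<open>As a multiple of a positive part the function is visibly continuous and nonnegative.\<close>

lemma h_bar_eq: "h_bar x = 3 / (4 * ell ^ 3) * max 0 (ell\<^sup>2 - x\<^sup>2)"
proof -
  have p: "3/4 * ell powi (-3) = 3 / (4 * ell ^ 3)"
    by (simp add: power_int_minus divide_simps)
  show ?thesis
  proof (cases "x \<in> {-ell..ell}")
    case True
    then have "\<bar>x\<bar> \<le> \<bar>ell\<bar>" using ell_pos by auto
    then have "x\<^sup>2 \<le> ell\<^sup>2" by (rule abs_le_square_iff[THEN iffD1])
    then show ?thesis using True unfolding h_bar_def p by simp
  next
    case False
    then have "\<bar>ell\<bar> \<le> \<bar>x\<bar>" using ell_pos by auto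
    then have "ell\<^sup>2 \<le> x\<^sup>2" by (rule abs_le_square_iff[THEN iffD1])
    then have "max 0 (ell\<^sup>2 - x\<^sup>2) = 0" by simp
    moreover have "h_bar x = 0" unfolding h_bar_def using False by (rule if_not_P)
    ultimately show ?thesis by (simp only: mult_zero_right)
  qed
qed

lemma continuous_h_bar: "continuous_on UNIV (\<lambda>x. h_bar (x - t))"
  unfolding h_bar_eq by (intro continuous_intros)

definition h_bar_deriv :: "real \<Rightarrow> real \<Rightarrow> real" where
  "h_bar_deriv t x = indicator {t - ell..t + ell} x * (- (3 / (2 * ell ^ 3)) * (x - t))"

lemma h_bar_shift: "h_bar (x - t) = indicator {t - ell..t + ell} x * (3 / (4 * ell ^ 3) * (ell\<^sup>2 - (x - t)\<^sup>2))"
proof -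
  have p: "3/4 * ell powi (-3) = 3 / (4 * ell ^ 3)"
    by (simp add: power_int_minus divide_simps)
  show ?thesis unfolding h_bar_def p by (auto simp: indicator_def)
qed

lemma h_bar_weak_gradient: "has_weak_gradient (\<lambda>x. h_bar (x - t)) (h_bar_deriv t) UNIV"
  unfolding has_weak_gradient_def
proof (intro conjI allI impI ballI)
  let ?Q = "\<lambda>x. 3 / (4 * ell ^ 3) * (ell\<^sup>2 - (x - t)\<^sup>2)" and ?Q' = "\<lambda>x. - (3 / (2 * ell ^ 3)) * (x - t)"
  let ?I = "{t - ell..t + ell}"
  show "loc_integrable UNIV (\<lambda>x. h_bar (x - t))"
    by (rule continuous_imp_loc_integrable[OF continuous_h_bar])
  have "set_integrable lborel ?I ?Q'" by (intro borel_integrable_atLeastAtMost' continuous_intros)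
  then have "integrable lborel (h_bar_deriv t)" by (simp add: set_integrable_def h_bar_deriv_def[abs_def])
  then show "loc_integrable UNIV (h_bar_deriv t)"
    unfolding loc_integrable_def set_integrable_def
    by (intro allI impI integrable_mult_indicator) (simp_all add: borel_compact)
  fix \<phi> :: "real \<Rightarrow> real" and b :: real
  assume \<phi>: "test_fun UNIV \<phi>" and b: "b \<in> Basis"
  let ?d = "\<lambda>x. frechet_derivative \<phi> (at x) b"
  have b1: "b = 1" using b by simp
  have c\<phi>: "continuous_on UNIV \<phi>" "continuous_on UNIV ?d"
    using test_fun_continuous[OF \<phi>] test_fun_continuous_deriv[OF \<phi> b] by auto
  have D\<phi>: "(\<phi> has_real_derivative ?d x) (at x)" for x
  proof -
    have d: "\<phi> differentiable at x" by (rule test_fun_differentiable[OF \<phi>])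
    have "frechet_derivative \<phi> (at x) v = ?d x * v" for v
      using linear_cmul[OF linear_frechet_derivative[OF d], of v 1] b1 by simp
    then have "frechet_derivative \<phi> (at x) = (*) (?d x)" by (rule ext)
    then show ?thesis
      using d[unfolded frechet_derivative_works] unfolding has_field_derivative_def by simp
  qed
  have DQ: "(?Q has_real_derivative ?Q' x) (at x)" for x
  proof -
    have "((\<lambda>x. ell\<^sup>2 - (x - t)\<^sup>2) has_real_derivative - 2 * (x - t)) (at x)"
      by (auto intro!: derivative_eq_intros)
    from DERIV_cmult[OF this, of "3 / (4 * ell ^ 3)"] show ?thesis
      by (rule DERIV_cong) (use ell_pos in \<open>simp add: field_simps\<close>)
  qed
  have i1: "set_integrable lborel ?I (\<lambda>x. ?Q x * ?d x)" and i2: "set_integrable lborel ?I (\<lambda>x. ?Q' x * \<phi> x)"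
    by (intro borel_integrable_atLeastAtMost' continuous_intros continuous_on_subset[OF c\<phi>(1)]
        continuous_on_subset[OF c\<phi>(2)] subset_UNIV)+
  have "(LINT x:?I|lborel. ?Q x * ?d x + ?Q' x * \<phi> x) = ?Q (t + ell) * \<phi> (t + ell) - ?Q (t - ell) * \<phi> (t - ell)"
    unfolding set_lebesgue_integral_def
  proof (rule integral_FTC_atLeastAtMost)
    show "t - ell \<le> t + ell" using ell_pos by simp
    have "((\<lambda>x. ?Q x * \<phi> x) has_real_derivative ?Q x * ?d x + ?Q' x * \<phi> x) (at x)" for x
      by (rule DERIV_cong[OF DERIV_mult[OF DQ D\<phi>]]) (simp only: mult.commute add.commute)
    then show "((\<lambda>x. ?Q x * \<phi> x) has_vector_derivative ?Q x * ?d x + ?Q' x * \<phi> x) (at x within ?I)" for x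
      unfolding has_real_derivative_iff_has_vector_derivative[symmetric]
      by (rule has_field_derivative_at_within)
    show "continuous_on ?I (\<lambda>x. ?Q x * ?d x + ?Q' x * \<phi> x)"
      by (intro continuous_intros continuous_on_subset[OF c\<phi>(1)]
        continuous_on_subset[OF c\<phi>(2)] subset_UNIV)
  qed
  also have "\<dots> = 0" by simp
  finally have "(LINT x:?I|lborel. ?Q x * ?d x) + (LINT x:?I|lborel. ?Q' x * \<phi> x) = 0"
    by (simp only: set_integral_add(2)[OF i1 i2])
  moreover have "(LINT x:UNIV|lborel. h_bar (x - t) * ?d x) = (LINT x:?I|lborel. ?Q x * ?d x)"
    unfolding h_bar_shift set_lebesgue_integral_def by (simp add: mult.assoc)
  moreover have "(LINT x:UNIV|lborel. (h_bar_deriv t x \<bullet> b) * \<phi> x) = (LINT x:?I|lborel. ?Q' x * \<phi> x)"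
    unfolding h_bar_deriv_def set_lebesgue_integral_def b1 by (simp only: indicator_UNIV inner_real_def mult_1_left mult_1_right scaleR_one real_scaleR_def mult.assoc)
  ultimately show "(LINT x:UNIV|lborel. h_bar (x - t) * ?d x) = - (LINT x:UNIV|lborel. (h_bar_deriv t x \<bullet> b) * \<phi> x)"
    by linarith
qed

lemma integral_shifted_interval:
  fixes F f :: "real \<Rightarrow> real"
  assumes "\<And>x. (F has_real_derivative f x) (at x)" "continuous_on UNIV f"
  shows "integrable lborel (\<lambda>x. indicator {t - ell..t + ell} x * f x)"
    and "(\<integral>x. indicator {t - ell..t + ell} x * f x \<partial>lborel) = F (t + ell) - F (t - ell)"
proof -
  show "integrable lborel (\<lambda>x. indicator {t - ell..t + ell} x * f x)"
    using borel_integrable_atLeastAtMost'[OF continuous_on_subset[OF assms(2) subset_UNIV]]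
    by (simp add: set_integrable_def)
  have "(\<integral>x. indicator {t - ell..t + ell} x *\<^sub>R f x \<partial>lborel) = F (t + ell) - F (t - ell)"
  proof (rule integral_FTC_atLeastAtMost)
    show "t - ell \<le> t + ell" using ell_pos by simp
    show "(F has_vector_derivative f x) (at x within {t - ell..t + ell})" for x
      using assms(1) unfolding has_real_derivative_iff_has_vector_derivative[symmetric]
      by (rule has_field_derivative_at_within)
  qed (rule continuous_on_subset[OF assms(2) subset_UNIV])
  then show "(\<integral>x. indicator {t - ell..t + ell} x * f x \<partial>lborel) = F (t + ell) - F (t - ell)" by simp
qed

lemma h_bar_integral: 
  "integrable lborel (\<lambda>x. h_bar (x - t))" "(\<integral>x. h_bar (x - t) \<partial>lborel) = 1"
proof -
  let ?F = "\<lambda>x. 3 / (4 * ell ^ 3) * (ell\<^sup>2 * (x - t) - (x - t) ^ 3 / 3)"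
  have D: "(?F has_real_derivative 3 / (4 * ell ^ 3) * (ell\<^sup>2 - (x - t)\<^sup>2)) (at x)" for x
    by (rule DERIV_cmult) (auto intro!: derivative_eq_intros)
  have C: "continuous_on UNIV (\<lambda>x. 3 / (4 * ell ^ 3) * (ell\<^sup>2 - (x - t)\<^sup>2))" by (intro continuous_intros)
  show "integrable lborel (\<lambda>x. h_bar (x - t))"
    unfolding h_bar_shift by (rule integral_shifted_interval(1)[OF D C])
  have "(\<integral>x. h_bar (x - t) \<partial>lborel) = ?F (t + ell) - ?F (t - ell)"
    unfolding h_bar_shift by (rule integral_shifted_interval(2)[OF D C])
  also have "\<dots> = 1" using ell_pos by (simp add: field_simps eval_nat_numeral)
  finally show "(\<integral>x. h_bar (x - t) \<partial>lborel) = 1" .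
qed

lemma h_bar_deriv_square_integral:
  "integrable lborel (\<lambda>x. (h_bar_deriv t x)\<^sup>2)" "(\<integral>x. (h_bar_deriv t x)\<^sup>2 \<partial>lborel) = 3 / (2 * ell ^ 3)"
proof -
  let ?F = "\<lambda>x. 9 / (4 * ell ^ 6) * ((x - t) ^ 3 / 3)"
  have D: "(?F has_real_derivative 9 / (4 * ell ^ 6) * (x - t)\<^sup>2) (at x)" for x
    by (rule DERIV_cmult) (auto intro!: derivative_eq_intros)
  have C: "continuous_on UNIV (\<lambda>x. 9 / (4 * ell ^ 6) * (x - t)\<^sup>2)" by (intro continuous_intros)
  have e: "(h_bar_deriv t x)\<^sup>2 = indicator {t - ell..t + ell} x * (9 / (4 * ell ^ 6) * (x - t)\<^sup>2)" for x
  proof -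
    have "(- (3 / (2 * ell ^ 3)) * y)\<^sup>2 = 9 / (4 * ell ^ 6) * y\<^sup>2" for y
      by (simp add: power_mult_distrib power_divide power_mult[symmetric])
    from this[of "x - t"] show ?thesis by (simp add: h_bar_deriv_def indicator_def)
  qed
  show "integrable lborel (\<lambda>x. (h_bar_deriv t x)\<^sup>2)"
    unfolding e by (rule integral_shifted_interval(1)[OF D C])
  have "(\<integral>x. (h_bar_deriv t x)\<^sup>2 \<partial>lborel) = ?F (t + ell) - ?F (t - ell)"
    unfolding e by (rule integral_shifted_interval(2)[OF D C])
  also have "\<dots> = 3 / (2 * ell ^ 3)" using ell_pos by (simp add: field_simps eval_nat_numeral)
  finally show "(\<integral>x. (h_bar_deriv t x)\<^sup>2 \<partial>lborel) = 3 / (2 * ell ^ 3)" .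
qed

lemma h_bar_admissible: "(\<lambda>x. h_bar (x - t)) \<in> admissible"
proof -
  have "integrable lborel (\<lambda>x. (h_bar (x - t))\<^sup>2)"
  proof (rule integrable_continuous_compact_support[of "{t - ell..t + ell}"])
    show "continuous_on UNIV (\<lambda>x. (h_bar (x - t))\<^sup>2)" by (intro continuous_intros continuous_h_bar)
  qed (simp_all add: h_bar_shift)
  moreover have "h_bar (x - t) \<ge> 0" for x
    unfolding h_bar_eq using ell_pos by simp
  ultimately show ?thesis
    unfolding admissible_def H1_def
    using continuous_h_bar h_bar_weak_gradient h_bar_deriv_square_integral(1) h_bar_integral by blast
qed

lemma weak_deriv_works:
  assumes "h \<in> H1"
  shows "has_weak_gradient h (weak_deriv h) UNIV"
proof -
  have "\<exists>g. has_weak_gradient h g UNIV" using assms by (auto simp: H1_def)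
  then show ?thesis unfolding weak_deriv_def by (rule someI_ex)
qed

lemma G_h_bar: "G (\<lambda>x. h_bar (x - t)) = ennreal min_energy"
proof -
  let ?h = "\<lambda>x. h_bar (x - t)"
  have "{x. h_bar (x - t) > 0} = {t - ell<..<t + ell}"
  proof -
    have "h_bar (x - t) > 0 \<longleftrightarrow> x \<in> {t - ell<..<t + ell}" for x
    proof -
      have "3 / (4 * ell ^ 3) > 0" using ell_pos by simp
      then have "h_bar (x - t) > 0 \<longleftrightarrow> (x - t)\<^sup>2 < ell\<^sup>2"
        unfolding h_bar_eq by (simp only: zero_less_mult_iff) (auto simp: less_max_iff_disj)
      also have "\<dots> \<longleftrightarrow> \<bar>x - t\<bar> < ell"
        using ell_pos abs_le_square_iff[of ell "x - t"] by (simp add: not_le[symmetric])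
      also have "\<dots> \<longleftrightarrow> x \<in> {t - ell<..<t + ell}"
        unfolding greaterThanLessThan_iff by linarith
      finally show ?thesis .
    qed
    then show ?thesis by blast
  qed
  then have 1: "dirichlet_inf {x. h_bar (x - t) > 0} = ennreal (9 / (4 * ell ^ 3))"
    using dirichlet_inf_interval[of "t - ell" "t + ell"] ell_pos
    by (simp add: C_W_eq field_simps eval_nat_numeral)
  have "has_weak_gradient ?h (weak_deriv ?h) UNIV"
    using h_bar_admissible[of t] by (intro weak_deriv_works) (simp add: admissible_def)
  then have "AE x in lborel. weak_deriv ?h x = h_bar_deriv t x"
    using weak_gradient_unique[OF continuous_h_bar _ h_bar_weak_gradient] by blast
  then have "(\<integral>\<^sup>+x. ennreal ((weak_deriv ?h x)\<^sup>2) \<partial>lborel) = (\<integral>\<^sup>+x. ennreal ((h_bar_deriv t x)\<^sup>2) \<partial>lborel)"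
    by (intro nn_integral_cong_AE) auto
  also have "\<dots> = ennreal (3 / (2 * ell ^ 3))"
    using nn_integral_eq_integral[OF h_bar_deriv_square_integral(1)[of t]] h_bar_deriv_square_integral(2)[of t] by simp
  finally have 2: "(\<integral>\<^sup>+x. ennreal ((weak_deriv ?h x)\<^sup>2) \<partial>lborel) = ennreal (3 / (2 * ell ^ 3))" .
  have "9 / (4 * ell ^ 3) + 3 / (2 * ell ^ 3) = min_energy"
    using ell_pos by (simp add: min_energy_def field_simps)
  then show ?thesis
    unfolding G_def 1 2 using ell_pos by (simp add: ennreal_plus[symmetric] del: ennreal_plus)
qed

section \<open>The lower bound and its equality case\<close>

text \<open>Stated with extended nonnegative values so that unbounded components and infinite energies are covered: then the
  right-hand side is infinite and the equality case cannot occur.\<close>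

lemma component_energy:
  fixes h g :: "real \<Rightarrow> real"
  assumes h: "continuous_on UNIV h" "\<And>x. h x \<ge> 0" "integrable lborel h" "(\<integral>x. h x \<partial>lborel) = 1"
    and hg: "has_weak_gradient h g UNIV" and C: "C \<in> components {x. h x > 0}"
  defines "N \<equiv> (\<integral>\<^sup>+x\<in>C. ennreal (h x) \<partial>lborel)" and "D \<equiv> (\<integral>\<^sup>+x\<in>C. ennreal ((g x)\<^sup>2) \<partial>lborel)"
  shows "ennreal min_energy * N \<le> dirichlet_inf C + D"
    and "dirichlet_inf C + D \<le> ennreal min_energy * N \<Longrightarrow> \<exists>t. h = (\<lambda>x. h_bar (x - t))"
proof -
  let ?\<Omega> = "{x. h x > 0}"
  have op: "open ?\<Omega>" using open_Collect_less[of "\<lambda>_. 0" h] h(1) by (simp add: continuous_on_const)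
  have gm[measurable]: "g \<in> borel_measurable borel" by (rule weak_gradient_measurable[OF hg])
  have hm[measurable]: "h \<in> borel_measurable borel" by (rule borel_measurable_continuous_onI[OF h(1)])
  have me: "min_energy > 0" using ell_pos by (simp add: min_energy_def)
  have "N \<le> (\<integral>\<^sup>+x. ennreal (h x) \<partial>lborel)"
    unfolding N_def by (rule nn_integral_mono) (auto simp: indicator_def)
  also have "\<dots> = 1" using nn_integral_eq_integral[OF h(3)] h(2,4) by simp
  finally have N1: "N \<le> 1" .
  have Nfin: "ennreal min_energy * N < \<infinity>"
    using N1 by (auto simp: ennreal_mult_less_top intro: le_less_trans)
  have "ennreal min_energy * N \<le> dirichlet_inf C + D \<and>
    (dirichlet_inf C + D \<le> ennreal min_energy * N \<longrightarrow> (\<exists>t. h = (\<lambda>x. h_bar (x - t))))"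
  proof (cases "bounded C \<and> D \<noteq> \<infinity>")
    case False
    have "is_interval C" using in_components_connected[OF C] by (simp add: is_interval_connected_1)
    then have "dirichlet_inf C + D = \<infinity>" using False dirichlet_inf_unbounded[of C] by auto
    then show ?thesis using Nfin by auto
  next
    case True
    obtain a b where ab: "a < b" and C_eq: "C = {a<..<b}" and "a \<notin> ?\<Omega>" "b \<notin> ?\<Omega>"
      using bounded_component_interval[OF op C] True by blast
    then have h0: "h a = 0" "h b = 0" using h(2)[of a] h(2)[of b] by auto
    \<comment> \<open>Integration by parts lives on the half-open interval, which agrees with the component up to the point \<open>b\<close>.\<close>
    have ind: "AE x in lborel. x \<in> C \<longleftrightarrow> x \<in> {a<..b}"
      using AE_lborel_singleton[of b] by eventually_elim (auto simp: C_eq)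
    define m where "m = (LINT x:{a<..b}|lborel. h x)"
    define E where "E = (LINT x:{a<..b}|lborel. (g x)\<^sup>2)"
    have ih: "integrable lborel (\<lambda>x. indicator {a<..b} x *\<^sub>R h x)"
      by (rule integrable_mult_indicator[OF _ h(3)]) simp
    have "N = (\<integral>\<^sup>+x. ennreal (indicator {a<..b} x *\<^sub>R h x) \<partial>lborel)"
      unfolding N_def by (rule nn_integral_cong_AE) (use ind in \<open>eventually_elim, auto simp: indicator_def\<close>)
    also have "\<dots> = ennreal m"
      unfolding m_def set_lebesgue_integral_def
      by (rule nn_integral_eq_integral[OF ih]) (auto simp: h(2))
    finally have Nm: "N = ennreal m" .
    have m0: "m \<ge> 0"
      unfolding m_def set_lebesgue_integral_def by (rule Bochner_Integration.integral_nonneg) (auto simp: h(2))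
    have m1: "m \<le> 1" using N1 Nm by simp
    have De: "D = (\<integral>\<^sup>+x. ennreal (indicator {a<..b} x *\<^sub>R (g x)\<^sup>2) \<partial>lborel)"
      unfolding D_def by (rule nn_integral_cong_AE) (use ind in \<open>eventually_elim, auto simp: indicator_def\<close>)
    have ig: "integrable lborel (\<lambda>x. indicator {a<..b} x *\<^sub>R (g x)\<^sup>2)"
      by (rule integrableI_nonneg) (use True in \<open>auto simp: De less_top\<close>)
    have DE: "D = ennreal E"
      unfolding De E_def set_lebesgue_integral_def by (rule nn_integral_eq_integral[OF ig]) auto
    let ?L = "b - a" and ?c = "(a + b) / 2"
    let ?r = "\<lambda>x. (g x + 12 * m / ?L ^ 3 * (x - ?c))\<^sup>2"
    define R where "R = (LINT x:{a<..b}|lborel. ?r x)"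
    have sq: "set_integrable lborel {a<..b} (\<lambda>x. (g x)\<^sup>2)" using ig by (simp add: set_integrable_def)
    have E_eq: "E = 12 * m\<^sup>2 / ?L ^ 3 + R"
      unfolding E_def R_def m_def by (rule interval_deriv_energy(1)[OF h(1) hg ab h0 sq])
    have ir: "set_integrable lborel {a<..b} ?r"
      unfolding m_def by (rule interval_deriv_energy(2)[OF h(1) hg ab h0 sq])
    have R0: "R \<ge> 0" unfolding R_def set_lebesgue_integral_def by (rule Bochner_Integration.integral_nonneg) auto
    have E0: "E \<ge> 0" unfolding E_def set_lebesgue_integral_def by (rule Bochner_Integration.integral_nonneg) auto
    have L: "?L > 0" using ab by simp
    have sum_eq: "dirichlet_inf C + D = ennreal (C_W * ?L\<^sup>2 + E)"
      unfolding C_eq dirichlet_inf_interval[OF ab] DE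
      using C_W_pos E0 by (simp add: ennreal_plus)
    have min_eq: "ennreal min_energy * N = ennreal (min_energy * m)"
      unfolding Nm using me m0 by (simp add: ennreal_mult)
    note bound = interval_energy_bound[OF L m0 m1]
    have lower: "min_energy * m \<le> C_W * ?L\<^sup>2 + E" using bound(1) E_eq R0 by linarith
    have "\<exists>t. h = (\<lambda>x. h_bar (x - t))" if le: "ennreal (C_W * ?L\<^sup>2 + E) \<le> ennreal (min_energy * m)"
    proof -
      have "C_W * ?L\<^sup>2 + E \<le> min_energy * m"
        using le me m0 by (simp add: ennreal_le_iff)
      then have "min_energy * m = C_W * ?L\<^sup>2 + 12 * m\<^sup>2 / ?L ^ 3" and "R = 0"
        using bound(1) E_eq R0 by linarith+
      from bound(2)[OF this(1)] have m: "m = 1" and Lell: "?L = 2 * ell" by auto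
      have a: "a = ?c - ell" and b: "b = ?c + ell" using Lell by (simp_all add: field_simps)
      let ?k = "3 / (2 * ell ^ 3)"
      have k: "12 * m / ?L ^ 3 = ?k" unfolding m Lell using ell_pos by (simp add: field_simps)
      have "AE x in lborel. indicator {a<..b} x *\<^sub>R ?r x = 0"
        using \<open>R = 0\<close> integral_nonneg_eq_0_iff_AE[OF ir[unfolded set_integrable_def]]
        unfolding R_def set_lebesgue_integral_def by auto
      then have gx: "AE x in lborel. x \<in> {a<..b} \<longrightarrow> g x = - ?k * (x - ?c)"
        unfolding k by eventually_elim (auto simp: indicator_def)
      \<comment> \<open>On the interval \<open>h\<close> and the parabola share their weak derivative and their value at \<open>a\<close>.\<close>
      have inside: "h x = h_bar (x - ?c)" if x: "x \<in> {a..b}" for x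
      proof -
        have "h x - h a = (LINT y:{a<..x}|lborel. g y)"
          by (rule weak_gradient_FTC[OF h(1) hg, symmetric]) (use x in auto)
        also have "\<dots> = (LINT y:{a<..x}|lborel. h_bar_deriv ?c y)"
          unfolding set_lebesgue_integral_def
        proof (rule integral_cong_AE)
          show "AE y in lborel. indicator {a<..x} y *\<^sub>R g y = indicator {a<..x} y *\<^sub>R h_bar_deriv ?c y"
            using gx
          proof eventually_elim
            case (elim y)
            show ?case
            proof (cases "y \<in> {a<..x}")
              case True
              then have "y \<in> {?c - ell..?c + ell}" "y \<in> {a<..b}" using x a b by auto
              then show ?thesis using elim by (simp only: h_bar_deriv_def indicator_simps mult_1_left)
            qed simp
          qed
        next
          have [measurable]: "h_bar_deriv ?c \<in> borel_measurable borel"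
            by (rule weak_gradient_measurable[OF h_bar_weak_gradient])
          show "(\<lambda>y. indicator {a<..x} y *\<^sub>R h_bar_deriv ?c y) \<in> borel_measurable lborel" by measurable
        qed measurable
        also have "\<dots> = h_bar (x - ?c) - h_bar (a - ?c)"
          by (rule weak_gradient_FTC[OF continuous_h_bar h_bar_weak_gradient]) (use x in auto)
        also have "h_bar (a - ?c) = 0"
        proof -
          have "a - ?c = - ell" using a by linarith
          then show ?thesis by (simp only: h_bar_eq) simp
        qed
        finally show ?thesis using h0 by simp
      qed
      \<comment> \<open>No mass is left outside the interval, and an open set on which a positive function has no mass is empty.\<close>
      let ?W = "?\<Omega> \<inter> - {a..b}"
      have "?W = {}"
      proof (rule open_null_imp_empty)
        show "open ?W" using op by (intro open_Int) auto
        let ?f = "\<lambda>x. h x - indicator {a<..b} x *\<^sub>R h x"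
        have "integrable lborel ?f" by (rule Bochner_Integration.integrable_diff[OF h(3) ih])
        moreover have "(\<integral>x. ?f x \<partial>lborel) = 0"
          using Bochner_Integration.integral_diff[OF h(3) ih] h(4) m unfolding m_def set_lebesgue_integral_def by simp
        moreover have "AE x in lborel. 0 \<le> ?f x" using h(2) by (auto simp: indicator_def)
        ultimately have "AE x in lborel. ?f x = 0" using integral_nonneg_eq_0_iff_AE by blast
        then show "AE x in lborel. x \<notin> ?W" by eventually_elim (auto simp: indicator_def split: if_splits)
      qed
      then have outside: "h x = 0" if "x \<notin> {a..b}" for x using that h(2)[of x] by force
      have "h x = h_bar (x - ?c)" for x
      proof (cases "x \<in> {a..b}")
        case False
        then have "x - ?c \<notin> {-ell..ell}" using a b by auto
        then have "h_bar (x - ?c) = 0" unfolding h_bar_def by (rule if_not_P)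
        then show ?thesis using outside[OF False] by simp
      qed (rule inside)
      then show ?thesis by blast
    qed
    then show ?thesis
      unfolding sum_eq min_eq using lower by (simp add: ennreal_leI)
  qed
  then show "ennreal min_energy * N \<le> dirichlet_inf C + D"
    and "dirichlet_inf C + D \<le> ennreal min_energy * N \<Longrightarrow> \<exists>t. h = (\<lambda>x. h_bar (x - t))" by blast+
qed

text \<open>Summing \<open>component_energy\<close> over the components gives the bound. If the sum of the energies does not exceed the sum of
  their lower bounds, which is finite, equality must hold for every component, and one component is enough to identify
  the function.\<close>

lemma G_lower_bound:
  assumes k: "k \<in> admissible"
  shows "ennreal min_energy \<le> G k"
    and "G k \<le> ennreal min_energy \<Longrightarrow> \<exists>t. k = (\<lambda>x. h_bar (x - t))"
proof -
  let ?\<Omega> = "{x. k x > 0}" and ?g = "weak_deriv k"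
  let ?\<C> = "components ?\<Omega>"
  have kH: "k \<in> H1" and k0: "\<And>x. k x \<ge> 0" and ki: "integrable lborel k" and k1: "(\<integral>x. k x \<partial>lborel) = 1"
    using k by (auto simp: admissible_def)
  have kc: "continuous_on UNIV k" using kH by (simp add: H1_def)
  have kg: "has_weak_gradient k ?g UNIV" by (rule weak_deriv_works[OF kH])
  have op: "open ?\<Omega>" using open_Collect_less[of "\<lambda>_. 0" k] kc by (simp add: continuous_on_const)
  have [measurable]: "?g \<in> borel_measurable borel" by (rule weak_gradient_measurable[OF kg])
  have [measurable]: "k \<in> borel_measurable borel" by (rule borel_measurable_continuous_onI[OF kc])
  have opC: "open C" if "C \<in> ?\<C>" for C using open_components[OF op that] .
  have disj: "disjoint ?\<C>" unfolding disjoint_def using components_nonoverlap by blast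
  have cnt: "countable ?\<C>"
    by (rule countable_disjoint_open_subsets[OF opC]) (use disj in \<open>auto simp: pairwise_def disjnt_def disjoint_def\<close>)
  let ?N = "\<lambda>C. \<integral>\<^sup>+x\<in>C. ennreal (k x) \<partial>lborel" and ?D = "\<lambda>C. \<integral>\<^sup>+x\<in>C. ennreal ((?g x)\<^sup>2) \<partial>lborel"
  have split: "(\<integral>\<^sup>+C. (\<integral>\<^sup>+x\<in>C. f x \<partial>lborel) \<partial>count_space ?\<C>) = (\<integral>\<^sup>+x\<in>?\<Omega>. f x \<partial>lborel)"
    if [measurable]: "f \<in> borel_measurable borel" for f :: "real \<Rightarrow> ennreal"
  proof -
    have "(\<integral>\<^sup>+C. (\<integral>\<^sup>+x\<in>C. f x \<partial>lborel) \<partial>count_space ?\<C>) = (\<integral>\<^sup>+C. emeasure (density lborel f) C \<partial>count_space ?\<C>)"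
      by (rule nn_integral_cong) (use opC in \<open>auto simp: emeasure_density\<close>)
    also have "\<dots> = emeasure (density lborel f) (\<Union>((\<lambda>C. C) ` ?\<C>))"
      by (rule emeasure_UN_countable[symmetric])
         (use cnt disj opC in \<open>auto simp: disjoint_family_on_def disjoint_def\<close>)
    also have "\<dots> = (\<integral>\<^sup>+x\<in>?\<Omega>. f x \<partial>lborel)"
      using op by (simp add: emeasure_density)
    finally show ?thesis .
  qed
  have "(\<integral>\<^sup>+C. ?N C \<partial>count_space ?\<C>) = (\<integral>\<^sup>+x\<in>?\<Omega>. ennreal (k x) \<partial>lborel)"
    by (rule split) measurable
  also have "\<dots> = (\<integral>\<^sup>+x. ennreal (k x) \<partial>lborel)"
    by (rule nn_integral_cong) (use k0 in \<open>auto simp: indicator_def not_less intro: antisym\<close>)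
  also have "\<dots> = 1" using nn_integral_eq_integral[OF ki] k0 k1 by simp
  finally have N: "(\<integral>\<^sup>+C. ennreal min_energy * ?N C \<partial>count_space ?\<C>) = ennreal min_energy"
    by (simp add: nn_integral_cmult)
  have "(\<integral>\<^sup>+C. dirichlet_inf C + ?D C \<partial>count_space ?\<C>)
      = (\<integral>\<^sup>+C. dirichlet_inf C \<partial>count_space ?\<C>) + (\<integral>\<^sup>+C. ?D C \<partial>count_space ?\<C>)"
    by (rule nn_integral_add) auto
  also have "\<dots> \<le> dirichlet_inf ?\<Omega> + (\<integral>\<^sup>+x. ennreal ((?g x)\<^sup>2) \<partial>lborel)"
  proof (rule add_mono)
    show "(\<integral>\<^sup>+C. dirichlet_inf C \<partial>count_space ?\<C>) \<le> dirichlet_inf ?\<Omega>"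
      using dirichlet_inf_superadditive[OF cnt opC disj] by simp
    have "(\<integral>\<^sup>+C. ?D C \<partial>count_space ?\<C>) = (\<integral>\<^sup>+x\<in>?\<Omega>. ennreal ((?g x)\<^sup>2) \<partial>lborel)"
      by (rule split) measurable
    also have "\<dots> \<le> (\<integral>\<^sup>+x. ennreal ((?g x)\<^sup>2) \<partial>lborel)"
      by (rule nn_integral_mono) (auto simp: indicator_def)
    finally show "(\<integral>\<^sup>+C. ?D C \<partial>count_space ?\<C>) \<le> (\<integral>\<^sup>+x. ennreal ((?g x)\<^sup>2) \<partial>lborel)" .
  qed
  also have "\<dots> = G k" by (simp add: G_def)
  finally have E: "(\<integral>\<^sup>+C. dirichlet_inf C + ?D C \<partial>count_space ?\<C>) \<le> G k" .
  note comp = component_energy[OF kc k0 ki k1 kg]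
  have "(\<integral>\<^sup>+C. ennreal min_energy * ?N C \<partial>count_space ?\<C>)
      \<le> (\<integral>\<^sup>+C. dirichlet_inf C + ?D C \<partial>count_space ?\<C>)"
    by (rule nn_integral_mono) (simp add: comp(1))
  then show "ennreal min_energy \<le> G k" using E unfolding N by (rule order_trans)
  assume le: "G k \<le> ennreal min_energy"
  have "\<exists>x. k x > 0"
  proof (rule ccontr)
    assume "\<nexists>x. k x > 0"
    then have "k x = 0" for x using k0[of x] by (simp add: not_less order_antisym)
    then show False using k1 by simp
  qed
  then have "?\<C> \<noteq> {}" by auto
  then obtain C where C: "C \<in> ?\<C>" by blast
  have "dirichlet_inf C + ?D C \<le> ennreal min_energy * ?N C"
  proof (rule ccontr)
    assume "\<not> ?thesis"
    then have "(\<integral>\<^sup>+C. ennreal min_energy * ?N C \<partial>count_space ?\<C>) < (\<integral>\<^sup>+C. dirichlet_inf C + ?D C \<partial>count_space ?\<C>)"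
    proof (intro nn_integral_less)
      show "AE C in count_space ?\<C>. ennreal min_energy * ?N C \<le> dirichlet_inf C + ?D C"
        unfolding AE_count_space using comp(1) by blast
      show "\<not> (AE C in count_space ?\<C>. dirichlet_inf C + ?D C \<le> ennreal min_energy * ?N C)"
        unfolding AE_count_space using C \<open>\<not> _ \<le> _\<close> by blast
      show "(\<integral>\<^sup>+C. ennreal min_energy * ?N C \<partial>count_space ?\<C>) \<noteq> \<infinity>"
        unfolding N by simp
    qed simp_all
    also have "\<dots> \<le> G k" by (rule E)
    also have "\<dots> \<le> ennreal min_energy" by (rule le)
    finally show False unfolding N by simp
  qed
  then show "\<exists>t. k = (\<lambda>x. h_bar (x - t))" by (rule comp(2)[OF C])
qed

theorem proposition3p37:
  shows "is_minimizer h_bar \<and>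
         (\<forall>h. is_minimizer h \<longleftrightarrow> (\<exists>t. h = (\<lambda>x. h_bar (x - t))))"
proof -
  have min: "is_minimizer (\<lambda>x. h_bar (x - t))" for t
    unfolding is_minimizer_def G_h_bar using h_bar_admissible G_lower_bound(1) by blast
  have "\<exists>t. h = (\<lambda>x. h_bar (x - t))" if "is_minimizer h" for h
  proof (rule G_lower_bound(2))
    show "h \<in> admissible" using that by (simp add: is_minimizer_def)
    have "G h \<le> G (\<lambda>x. h_bar (x - 0))"
      using that h_bar_admissible[of 0] unfolding is_minimizer_def by blast
    then show "G h \<le> ennreal min_energy" by (simp only: G_h_bar)
  qed
  then show ?thesis using min min[of 0] by auto
qed

end
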